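(* There is a linear-time algorithm which, given a tree $T$, outputs a detection pair $(W,L)$ of $T$ with $|W|+|L|\le 2\cdot DP(T)$. That is, \textsc{Opt-Detection Pair} admits a linear-time $2$-approximation algorithm on trees.
   Context: All graphs are finite, simple and undirected, and $d(u,v)$ denotes the distance in the graph. A vertex $w$ dominates all vertices of its closed neighbourhood $N[w]$ (its neighbours together with $w$). A vertex $l$ separates vertices $u,v$ if $d(u,l)\neq d(v,l)$. Given $W\subseteq V(G)$ (watchers) and $L\subseteq V(G)$ (listeners), a vertex $u$ is distinguished by $(W,L)$ if either $u$ is dominated by a vertex of $W$, or for every other vertex $v$, either $v$ is dominated by a vertex of $W$ or some vertex of $L$ separates $u$ and $v$. The pair $(W,L)$ (where $W\cap L\neq\emptyset$ is allowed) is a detection pair of $G$ if every vertex of $G$ is distinguished by $(W,L)$; its size is $|W|+|L|$. $DP(G)$ is the minimum size of a detection pair of $G$. \textsc{Opt-Detection Pair}: given a graph $G$, compute a detection pair of minimum size. *)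

theory Defs
  imports "Graph_Theory.Graph_Theory"
begin

section \<open>Detection pairs\<close>

text \<open>
  A finite simple undirected graph is a \<^locale>\<open>pair_graph\<close>: a finite, symmetric, loop-free
  set of ordered pairs over a finite vertex set.
\<close>

text \<open>
  The distance is the least number of arcs of a walk; it is \<open>\<infinity>\<close> between different components.
\<close>

definition gdist :: "'a pair_pre_digraph \<Rightarrow> 'a \<Rightarrow> 'a \<Rightarrow> ereal" where
  "gdist G u v = wf_digraph.\<mu> (with_proj G) (\<lambda>_. 1) u v"

definition dominated :: "'a pair_pre_digraph \<Rightarrow> 'a set \<Rightarrow> 'a \<Rightarrow> bool" where
  "dominated G W u \<longleftrightarrow> (\<exists>w\<in>W. u = w \<or> (w, u) \<in> parcs G)"

definition separates :: "'a pair_pre_digraph \<Rightarrow> 'a \<Rightarrow> 'a \<Rightarrow> 'a \<Rightarrow> bool" where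
  "separates G l u v \<longleftrightarrow> gdist G u l \<noteq> gdist G v l"

definition distinguished :: "'a pair_pre_digraph \<Rightarrow> 'a set \<Rightarrow> 'a set \<Rightarrow> 'a \<Rightarrow> bool" where
  "distinguished G W L u \<longleftrightarrow>
     dominated G W u \<or>
     (\<forall>v\<in>pverts G. v \<noteq> u \<longrightarrow> dominated G W v \<or> (\<exists>l\<in>L. separates G l u v))"

definition detection_pair :: "'a pair_pre_digraph \<Rightarrow> 'a set \<Rightarrow> 'a set \<Rightarrow> bool" where
  "detection_pair G W L \<longleftrightarrow>
     W \<subseteq> pverts G \<and> L \<subseteq> pverts G \<and> (\<forall>u\<in>pverts G. distinguished G W L u)"

definition DP :: "'a pair_pre_digraph \<Rightarrow> nat" where
  "DP G = (LEAST k. \<exists>W L. detection_pair G W L \<and> k = card W + card L)"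

lemma detection_pair_verts: "detection_pair G (pverts G) {}"
  by (auto simp: detection_pair_def distinguished_def dominated_def)

lemma DP_attained: "\<exists>W L. detection_pair G W L \<and> DP G = card W + card L"
  unfolding DP_def by (rule LeastI_ex) (use detection_pair_verts in blast)

lemma DP_le: "detection_pair G W L \<Longrightarrow> DP G \<le> card W + card L"
  unfolding DP_def by (rule Least_le) blast

text \<open>
  The predicates \<^const>\<open>forest\<close> and \<^const>\<open>tree\<close> of the library are meant for oriented graphs:
  in a symmetric digraph every edge yields a cycle \<open>u, v, u\<close> of length 2. In a simple undirected
  graph the cycles are exactly the directed cycles of length at least 3.
\<close>

definition undirected_tree :: "'a pair_pre_digraph \<Rightarrow> bool" where
  "undirected_tree G \<longleftrightarrow>
     pair_graph G \<and> Digraph_Component.connected (with_proj G) \<and>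
     \<not> (\<exists>p. pre_digraph.cycle (with_proj G) p \<and> 3 \<le> length p)"


section \<open>Random access machine programs\<close>

text \<open>
  The machine model is the unit-cost RAM with addition and (truncated) subtraction and with words
  of logarithmic length, presented as a structured programming language. A program uses finitely
  many registers and finitely many arrays (memory segments). Evaluating a
  node of an expression, or of a test, and every elementary step of a command takes one unit of
  time. All words hold numbers at most \<open>B\<close>; a computation in which some constant, address or
  intermediate result exceeds \<open>B\<close> has no derivation below. Taking \<open>B\<close> linear in the input size
  gives words of \<open>log n + O(1)\<close> bits.
\<close>

type_synonym name = string

record state =
  reg :: "name \<Rightarrow> nat"
  mem :: "name \<Rightarrow> nat \<Rightarrow> nat"

datatype aexp = N nat | V name | Read name aexp | Plus aexp aexp | Minus aexp aexp

datatype bexp = Less aexp aexp | Eq aexp aexp | Not bexp | And bexp bexp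

datatype com =
    Skip
  | Assign name aexp
  | Write name aexp aexp
  | Seq com com
  | If bexp com com
  | While bexp com

primrec aval :: "state \<Rightarrow> aexp \<Rightarrow> nat" where
  "aval s (N k) = k"
| "aval s (V x) = reg s x"
| "aval s (Read a e) = mem s a (aval s e)"
| "aval s (Plus e f) = aval s e + aval s f"
| "aval s (Minus e f) = aval s e - aval s f"

primrec bval :: "state \<Rightarrow> bexp \<Rightarrow> bool" where
  "bval s (Less e f) = (aval s e < aval s f)"
| "bval s (Eq e f) = (aval s e = aval s f)"
| "bval s (Not b) = (\<not> bval s b)"
| "bval s (And b d) = (bval s b \<and> bval s d)"

primrec acost :: "aexp \<Rightarrow> nat" where
  "acost (N k) = 1"
| "acost (V x) = 1"
| "acost (Read a e) = 1 + acost e"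
| "acost (Plus e f) = 1 + acost e + acost f"
| "acost (Minus e f) = 1 + acost e + acost f"

primrec bcost :: "bexp \<Rightarrow> nat" where
  "bcost (Less e f) = 1 + acost e + acost f"
| "bcost (Eq e f) = 1 + acost e + acost f"
| "bcost (Not b) = 1 + bcost b"
| "bcost (And b d) = 1 + bcost b + bcost d"

primrec afits :: "nat \<Rightarrow> state \<Rightarrow> aexp \<Rightarrow> bool" where
  "afits B s (N k) \<longleftrightarrow> k \<le> B"
| "afits B s (V x) \<longleftrightarrow> reg s x \<le> B"
| "afits B s (Read a e) \<longleftrightarrow> afits B s e \<and> mem s a (aval s e) \<le> B"
| "afits B s (Plus e f) \<longleftrightarrow> afits B s e \<and> afits B s f \<and> aval s e + aval s f \<le> B"
| "afits B s (Minus e f) \<longleftrightarrow> afits B s e \<and> afits B s f"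

primrec bfits :: "nat \<Rightarrow> state \<Rightarrow> bexp \<Rightarrow> bool" where
  "bfits B s (Less e f) \<longleftrightarrow> afits B s e \<and> afits B s f"
| "bfits B s (Eq e f) \<longleftrightarrow> afits B s e \<and> afits B s f"
| "bfits B s (Not b) \<longleftrightarrow> bfits B s b"
| "bfits B s (And b d) \<longleftrightarrow> bfits B s b \<and> bfits B s d"

text \<open>
  \<open>exec B p s t s'\<close>: started in \<open>s\<close>, the program \<open>p\<close> halts after exactly \<open>t\<close> time units in \<open>s'\<close>,
  with all words bounded by \<open>B\<close>.
\<close>

inductive exec :: "nat \<Rightarrow> com \<Rightarrow> state \<Rightarrow> nat \<Rightarrow> state \<Rightarrow> bool" for B :: nat where
  Skip: "exec B Skip s 1 s"
| Assign: "afits B s e \<Longrightarrow>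
    exec B (Assign x e) s (1 + acost e) (s\<lparr>reg := (reg s)(x := aval s e)\<rparr>)"
| Write: "afits B s i \<Longrightarrow> afits B s e \<Longrightarrow>
    exec B (Write a i e) s (1 + acost i + acost e)
      (s\<lparr>mem := (mem s)(a := (mem s a)(aval s i := aval s e))\<rparr>)"
| Seq: "exec B p s t s' \<Longrightarrow> exec B q s' t' s'' \<Longrightarrow> exec B (Seq p q) s (t + t') s''"
| IfTrue: "bfits B s b \<Longrightarrow> bval s b \<Longrightarrow> exec B p s t s' \<Longrightarrow>
    exec B (If b p q) s (1 + bcost b + t) s'"
| IfFalse: "bfits B s b \<Longrightarrow> \<not> bval s b \<Longrightarrow> exec B q s t s' \<Longrightarrow>
    exec B (If b p q) s (1 + bcost b + t) s'"
| WhileFalse: "bfits B s b \<Longrightarrow> \<not> bval s b \<Longrightarrow>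
    exec B (While b p) s (1 + bcost b) s"
| WhileTrue: "bfits B s b \<Longrightarrow> bval s b \<Longrightarrow> exec B p s t s' \<Longrightarrow>
    exec B (While b p) s' t' s'' \<Longrightarrow>
    exec B (While b p) s (1 + bcost b + t + t') s''"

inductive_cases exec_SkipE: "exec B Skip s t s'"
  and exec_AssignE: "exec B (Assign x e) s t s'"
  and exec_WriteE: "exec B (Write a i e) s t s'"
  and exec_SeqE: "exec B (Seq p q) s t s'"
  and exec_IfE: "exec B (If b p q) s t s'"
  and exec_WhileE: "exec B (While b p) s t s'"

lemma exec_deterministic:
  "exec B p s t s' \<Longrightarrow> exec B p s u s'' \<Longrightarrow> u = t \<and> s'' = s'"
proof (induction arbitrary: u s'' rule: exec.induct)
  case (Skip s)
  then show ?case by (auto elim: exec_SkipE)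
next
  case (Assign s e x)
  from Assign.prems show ?case by (rule exec_AssignE) simp
next
  case (Write s i e a)
  from Write.prems show ?case by (rule exec_WriteE) simp
next
  case (Seq p s t s' q t' s2)
  from Seq.prems show ?case by (rule exec_SeqE) (auto dest: Seq.IH)
next
  case (IfTrue s b p t s' q)
  from IfTrue.prems show ?case
    by (rule exec_IfE) (use IfTrue.hyps in \<open>auto dest: IfTrue.IH\<close>)
next
  case (IfFalse s b q t s' p)
  from IfFalse.prems show ?case
    by (rule exec_IfE) (use IfFalse.hyps in \<open>auto dest: IfFalse.IH\<close>)
next
  case (WhileFalse s b p)
  from WhileFalse.prems show ?case
    by (rule exec_WhileE) (use WhileFalse.hyps in auto)
next
  case (WhileTrue s b p t s' t' s2)
  from WhileTrue.prems show ?case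
    by (rule exec_WhileE) (use WhileTrue.hyps in \<open>auto dest: WhileTrue.IH\<close>)
qed


section \<open>Graphs as inputs, vertex sets as outputs\<close>

text \<open>
  The vertices of an input graph are numbered \<open>0, \<dots>, n - 1\<close>, and the graph is given by the
  lists of neighbours of its vertices, each in an arbitrary order.
\<close>

definition adjacency_lists :: "nat pair_pre_digraph \<Rightarrow> nat list list \<Rightarrow> bool" where
  "adjacency_lists G xs \<longleftrightarrow>
     pverts G = {..<length xs} \<and>
     (\<forall>v<length xs. distinct (xs ! v) \<and> set (xs ! v) = {u. (v, u) \<in> parcs G})"

text \<open>
  Register \<open>n\<close> holds the number of vertices. Array \<open>adj\<close> is the concatenation of the adjacency
  lists; the neighbours of \<open>v\<close> are found in its cells from \<open>off v\<close> to \<open>off (v + 1) - 1\<close>. All other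
  registers and cells are initially 0.
\<close>

definition input_state :: "nat list list \<Rightarrow> state" where
  "input_state xs =
     \<lparr>reg = (\<lambda>_. 0)(''n'' := length xs),
      mem = (\<lambda>_ _. 0)
        (''off'' := (\<lambda>i. if i \<le> length xs then length (concat (take i xs)) else 0),
         ''adj'' := (\<lambda>i. if i < length (concat xs) then concat xs ! i else 0))\<rparr>"

text \<open>An array \<open>a\<close> encodes a set of vertices by its characteristic vector.\<close>

definition output_set :: "state \<Rightarrow> name \<Rightarrow> nat \<Rightarrow> nat set" where
  "output_set s a n = {v. v < n \<and> mem s a v \<noteq> 0}"

end

theory Submission
  imports Defs
begin

text \<open>
  A leaf \<open>l\<close> starts a leg: the walk through vertices of degree 2 up to the first vertex \<open>apex l\<close> of
  another degree, which is entered from \<open>base l\<close>; the leg is short if it consists of \<open>l\<close> only. Two legs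
  at a vertex \<open>x\<close> that contain neither watchers nor listeners have first vertices that only \<open>x\<close> can
  dominate and that nothing separates; if both are long, their second vertices are in conflict even
  when \<open>x\<close> is a watcher. So with \<open>m\<close> long and \<open>k > 1\<close> legs in total at \<open>x\<close>, every detection pair spends
  at least \<open>k - 1\<close> on \<open>x\<close> and its legs, or at least \<open>max 1 m\<close> if \<open>x\<close> is a watcher. If one of
  these legs is short, the algorithm puts a watcher and a listener on \<open>x\<close>; it always puts a listener
  on the leaf of each long leg but the first. This costs at most twice as much. A path,
  where the legs end in leaves, gets its two leaves as listeners.

  This is a detection pair: a branch with a vertex of degree 3 contains a listener, because its
  outermost such vertex has two legs. If undominated \<open>u\<close> and \<open>v\<close> are not separated, the branches
  holding them at the midpoint of the path between them have no listener, so they are legs; two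
  long legs cannot both be without listener, and a short one makes the midpoint a watcher.

  The running time is linear since the legs are disjoint, except on a path, which is walked twice.
\<close>

section \<open>Trees as metric spaces\<close>

text \<open>The combinatorial part sees a tree only through its distances; no walks occur in it.
  \<open>closer_unique\<close> is acyclicity in metric form: at most one neighbour of
  \<open>u\<close> fails to be farther from \<open>r\<close> than \<open>u\<close>. The linear order
  on vertices serves to single out one long leg in \<open>tips\<close>.\<close>

locale metric_tree =
  fixes V :: "'a::linorder set" and E :: "'a \<Rightarrow> 'a \<Rightarrow> bool" and d :: "'a \<Rightarrow> 'a \<Rightarrow> nat"
  assumes finite_V: "finite V"
    and E_V: "E u v \<Longrightarrow> u \<in> V"
    and E_sym: "E u v \<Longrightarrow> E v u"
    and E_irrefl: "\<not> E u u"
    and d_0_iff: "u \<in> V \<Longrightarrow> v \<in> V \<Longrightarrow> d u v = 0 \<longleftrightarrow> u = v"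
    and d_sym: "u \<in> V \<Longrightarrow> v \<in> V \<Longrightarrow> d u v = d v u"
    and d_step: "E u w \<Longrightarrow> r \<in> V \<Longrightarrow> d w r \<le> Suc (d u r)"
    and closer_ex: "u \<in> V \<Longrightarrow> r \<in> V \<Longrightarrow> u \<noteq> r \<Longrightarrow> \<exists>w. E u w \<and> d u r = Suc (d w r)"
    and closer_unique:
      "E u w \<Longrightarrow> E u w' \<Longrightarrow> w \<noteq> w' \<Longrightarrow> r \<in> V \<Longrightarrow> d w r \<le> d u r \<Longrightarrow> d u r < d w' r"
begin

section \<open>Distances, parity and points between two vertices\<close>

lemma E_V': "E u v \<Longrightarrow> v \<in> V"
  using E_V E_sym by blast

lemma d_self [simp]: "u \<in> V \<Longrightarrow> d u u = 0"
  using d_0_iff by blast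

text \<open>If \<open>u\<close> is not \<open>r\<close>, it has one closer neighbour, and by
  \<open>closer_unique\<close> every other one is farther.\<close>

lemma d_adj:
  assumes "E u w" "r \<in> V"
  shows "d w r = Suc (d u r) \<or> d u r = Suc (d w r)"
proof (cases "u = r")
  case True
  then show ?thesis
    using assms d_step[of u w r] d_0_iff[of w r] E_irrefl E_V' by (metis d_self le_Suc_eq le_zero_eq)
next
  case False
  obtain w0 where w0: "E u w0" "d u r = Suc (d w0 r)"
    using closer_ex[of u r] False assms E_V by blast
  show ?thesis
    using closer_unique[of u w0 w r] w0 assms d_step[of u w r] by (cases "w = w0") auto
qed

lemma d_edge: "E u w \<Longrightarrow> d u w = 1"
  using d_adj[of u w w] E_V' by (auto simp: d_sym)

lemma d_far:
  assumes "E u w" "E u w'" "w \<noteq> w'" "r \<in> V" "d u r = Suc (d w r)"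
  shows "d w' r = Suc (d u r)"
  using closer_unique[of u w w' r] d_step[of u w' r] assms by auto

lemma d_triangle:
  assumes "u \<in> V" "v \<in> V" "w \<in> V"
  shows "d u w \<le> d u v + d v w"
  using assms
proof (induction "d u v" arbitrary: u)
  case 0
  then show ?case using d_0_iff by auto
next
  case (Suc k)
  then obtain u' where u': "E u u'" "d u v = Suc (d u' v)"
    using closer_ex[of u v] by (metis d_self nat.distinct(1))
  then show ?case
    using Suc.hyps(1)[of u'] Suc.hyps(2) Suc.prems d_step[OF E_sym[OF u'(1)], of w]
      E_V'[OF u'(1)] by simp
qed

text \<open>Trees are bipartite: one step of \<open>u\<close> changes both distances from
  \<open>u\<close> by exactly one. A listener equidistant from two vertices thus makes their
  distance even, which yields a midpoint.\<close>

lemma d_parity: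
  assumes "u \<in> V" "v \<in> V" "w \<in> V"
  shows "even (d u v + d u w + d v w)"
  using assms
proof (induction "d u v" arbitrary: u)
  case 0
  then show ?case using d_0_iff by auto
next
  case (Suc k)
  then obtain u' where u': "E u u'" "d u v = Suc (d u' v)"
    using closer_ex[of u v] by (metis d_self nat.distinct(1))
  then show ?case
    using Suc.hyps(1)[of u'] Suc.hyps(2) Suc.prems d_adj[OF u'(1), of w] E_V'[OF u'(1)] by auto
qed

lemma between_ex:
  assumes "u \<in> V" "v \<in> V" "i \<le> d u v"
  shows "\<exists>c\<in>V. d u c = i \<and> d c v = d u v - i"
  using assms(3)
proof (induction i)
  case 0
  then show ?case using assms by (intro bexI[of _ u]) auto
next
  case (Suc i)
  then obtain c where c: "c \<in> V" "d u c = i" "d c v = d u v - i" by auto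
  with Suc.prems have "c \<noteq> v" using assms by auto
  then obtain c' where c': "E c c'" "d c v = Suc (d c' v)"
    using closer_ex[of c v] c assms by blast
  have "c' \<in> V" using c' E_V' by blast
  moreover have "d u c' \<le> Suc i"
    using d_triangle[of u c c'] d_edge[of c c'] c c' assms \<open>c' \<in> V\<close> by auto
  moreover have "d u v \<le> d u c' + d c' v"
    using d_triangle[of u c' v] assms \<open>c' \<in> V\<close> by auto
  ultimately show ?case using c c' Suc.prems by (intro bexI[of _ c']) auto
qed

text \<open>The component of \<open>a\<close> in the tree without its neighbour \<open>c\<close>.\<close>

definition branch :: "'a \<Rightarrow> 'a \<Rightarrow> 'a set" where
  "branch a c = {z \<in> V. d z a < d z c}"

lemma branch_V: "branch a c \<subseteq> V"
  by (auto simp: branch_def)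

lemma finite_branch [simp]: "finite (branch a c)"
  using finite_V branch_V finite_subset by blast

lemma branch_self: "E a c \<Longrightarrow> a \<in> branch a c"
  using d_edge E_V by (auto simp: branch_def)

lemma branch_anchor: "E a c \<Longrightarrow> c \<notin> branch a c"
  using E_V' by (auto simp: branch_def)

lemma branch_d: "E a c \<Longrightarrow> z \<in> branch a c \<Longrightarrow> d z c = Suc (d z a)"
  using d_adj[of a c z] E_V E_V' by (auto simp: branch_def d_sym)

lemma branch_compl:
  "E a c \<Longrightarrow> z \<in> V \<Longrightarrow> z \<in> branch c a \<longleftrightarrow> z \<notin> branch a c"
  using d_adj[of a c z] E_V E_V' by (auto simp: branch_def d_sym)

lemma branch_disjoint:
  assumes "E c a" "E c b" "a \<noteq> b"
  shows "branch a c \<inter> branch b c = {}"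
proof (intro equals0I)
  fix z assume z: "z \<in> branch a c \<inter> branch b c"
  then show False
    using assms closer_unique[of c a b z] E_V[OF assms(1)] E_V'[OF assms(1)] E_V'[OF assms(2)]
    by (auto simp: branch_def d_sym)
qed

lemma branch_cover:
  assumes "z \<in> V" "c \<in> V" "z \<noteq> c"
  shows "\<exists>a. E c a \<and> z \<in> branch a c"
proof -
  obtain a where "E c a" "d c z = Suc (d a z)" using closer_ex[of c z] assms by blast
  then show ?thesis using assms E_V'[of c a] by (auto simp: branch_def d_sym)
qed

lemma branch_mono:
  assumes "E x y" "E x z" "y \<noteq> z"
  shows "branch y x \<subseteq> branch x z"
proof
  fix v assume v: "v \<in> branch y x"
  have V: "x \<in> V" "y \<in> V" "z \<in> V" "v \<in> V"
    using assms E_V E_V' v branch_V by blast+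
  have "d v x = Suc (d v y)" by (rule branch_d[OF E_sym[OF assms(1)] v])
  then have "d x v = Suc (d y v)" using d_sym V by metis
  then have "d z v = Suc (d x v)" by (rule d_far[OF assms V(4)])
  then show "v \<in> branch x z"
    using d_sym[OF V(4,1)] d_sym[OF V(4,3)] V by (simp add: branch_def)
qed

lemma branch_split:
  assumes "E x z"
  shows "branch x z = insert x (\<Union>y\<in>{y. E x y \<and> y \<noteq> z}. branch y x)"
proof (intro set_eqI iffI)
  fix v assume v: "v \<in> branch x z"
  then have "v \<in> V" using branch_V by blast
  show "v \<in> insert x (\<Union>y\<in>{y. E x y \<and> y \<noteq> z}. branch y x)"
  proof (cases "v = x")
    case False
    then obtain y where y: "E x y" "v \<in> branch y x"
      using branch_cover[of v x] \<open>v \<in> V\<close> E_V assms by blast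
    moreover have "y \<noteq> z" using v y by (auto simp: branch_def)
    ultimately show ?thesis by blast
  qed simp
next
  fix v assume "v \<in> insert x (\<Union>y\<in>{y. E x y \<and> y \<noteq> z}. branch y x)"
  then show "v \<in> branch x z"
    using branch_self[of x z] branch_mono[of x _ z] assms by auto
qed

text \<open>The edge from \<open>a\<close> to \<open>c\<close> is the only exit of the branch, so
  shortest paths to the outside pass through \<open>c\<close>.\<close>

lemma branch_dist:
  assumes ac: "E a c" and z: "z \<in> branch a c" and y: "y \<in> V" "y \<notin> branch a c"
  shows "d z y = d z c + d c y"
proof -
  have V: "a \<in> V" "c \<in> V" using ac E_V E_V' by auto
  have ay: "d a y = Suc (d c y)"
    using d_adj[of a c y] y ac V by (auto simp: branch_def d_sym)
  have "d z y = Suc (d z a) + d c y"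
    using z
  proof (induction "d z a" arbitrary: z rule: less_induct)
    case less
    have zV: "z \<in> V" using less.prems branch_V by blast
    show ?case
    proof (cases "z = a")
      case True
      then show ?thesis using ay V by auto
    next
      case False
      then obtain z' where z': "E z z'" "d z a = Suc (d z' a)"
        using closer_ex[of z a] zV V by blast
      have z'V: "z' \<in> V" using z' E_V' by blast
      have zc: "d z c = Suc (d z a)" using branch_d ac less.prems by blast
      have z'in: "z' \<in> branch a c"
        using d_step[OF E_sym[OF z'(1)], of c] z' zc z'V V by (simp add: branch_def)
      have IH: "d z' y = Suc (d z' a) + d c y" using less.hyps z' z'in by simp
      obtain z'' where z'': "E z' z''" "d z' y = Suc (d z'' y)"
        using closer_ex[of z' y] z'V y z'in by blast
      \<comment> \<open>The way from \<open>z'\<close> to \<open>y\<close> does not start back to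
        \<open>z\<close>, since \<open>z'\<close> has another neighbour nearer to \<open>y\<close>:
        \<open>c\<close> if \<open>z' = a\<close>, else the next vertex towards \<open>a\<close>.
        Hence \<open>z\<close> is one farther than \<open>z'\<close>.\<close>
      have "z'' \<noteq> z"
      proof
        assume "z'' = z"
        show False
        proof (cases "z' = a")
          case True
          then have "E z' c" "d z' y = Suc (d c y)" "c \<noteq> z"
            using ac ay less.prems branch_anchor by auto
          then show False
            using closer_unique[of z' c z y] z'' \<open>z'' = z\<close> y by auto
        next
          case False
          then obtain u where u: "E z' u" "d z' a = Suc (d u a)"
            using closer_ex[of z' a] z'V V by blast
          have uc: "d z' c = Suc (d z' a)" using branch_d ac z'in by blast
          have "u \<in> branch a c"
            using d_step[OF E_sym[OF u(1)], of c] u uc V E_V'[OF u(1)] by (simp add: branch_def)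
          then have "d u y = Suc (d u a) + d c y" using less.hyps u z' by simp
          moreover have "u \<noteq> z" using u z' by auto
          ultimately show False
            using closer_unique[of z' u z y] u z'' \<open>z'' = z\<close> y IH by auto
        qed
      qed
      then have "d z y = Suc (d z' y)"
        using d_far[of z' z'' z y] z'' z' E_sym y by blast
      then show ?thesis using IH z' by simp
    qed
  qed
  then show ?thesis using branch_d[OF ac z] by simp
qed

lemma branch_boundary:
  assumes "E a c" "z \<in> branch a c" "E z w" "w \<notin> branch a c"
  shows "z = a \<and> w = c"
proof -
  have V: "a \<in> V" "c \<in> V" "z \<in> V" "w \<in> V" using assms E_V E_V' by auto
  have "d z c + d c w = 1"
    using branch_dist[of a c z w] d_edge[of z w] assms V by simp
  moreover have "d z c = Suc (d z a)" using branch_d assms by blast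
  ultimately show ?thesis using d_0_iff V by auto
qed

text \<open>A common \<open>z\<close> would reach \<open>c'\<close> through \<open>c\<close> and
  \<open>c\<close> through \<open>c'\<close>, which forces \<open>c = c'\<close>; distinct branches
  at one vertex are disjoint.\<close>

lemma branches_disjoint:
  assumes "E a c" "E a' c'" "(a, c) \<noteq> (a', c')" "c \<notin> branch a' c'" "c' \<notin> branch a c"
  shows "branch a c \<inter> branch a' c' = {}"
proof (intro equals0I)
  fix z assume z: "z \<in> branch a c \<inter> branch a' c'"
  have V: "c \<in> V" "c' \<in> V" using assms E_V' by auto
  have "d z c' = d z c + d c c'" "d z c = d z c' + d c' c"
    using branch_dist[of a c z c'] branch_dist[of a' c' z c] assms V z by auto
  then have "d c c' = 0" by linarith
  then have "c = c'" using d_0_iff V by blast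
  then show False using assms z branch_disjoint[of c a a'] E_sym[of a c] E_sym[of a' c] by auto
qed

section \<open>Legs\<close>

definition deg :: "'a \<Rightarrow> nat" where
  "deg v = card {u. E v u}"

lemma finite_nbrs [simp]: "finite {u. E v u}"
  using finite_V E_V' by (metis finite_subset mem_Collect_eq subsetI)

lemma deg_pos: "E v u \<Longrightarrow> 0 < deg v"
  unfolding deg_def using card_gt_0_iff finite_nbrs by blast

lemma deg_1_V: "deg v = 1 \<Longrightarrow> v \<in> V"
  unfolding deg_def using E_V by (metis card_1_singletonE insertI1 mem_Collect_eq)

lemma nbrs_deg_1: "deg v = 1 \<Longrightarrow> E v u \<Longrightarrow> {w. E v w} = {u}"
  unfolding deg_def by (metis card_1_singletonE mem_Collect_eq singletonD)

lemma nbrs_deg_2: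
  assumes "deg v = 2" "E v u" "E v w" "u \<noteq> w"
  shows "{x. E v x} = {u, w}"
proof -
  have "{u, w} \<subseteq> {x. E v x}" "card {x. E v x} = card {u, w}"
    using assms by (auto simp: deg_def)
  then show ?thesis by (metis card_subset_eq finite_nbrs)
qed

lemma branch_leaf:
  assumes "deg l = 1" "E l x"
  shows "branch l x = {l}"
  using branch_split[OF assms(2)] nbrs_deg_1[OF assms] by auto

lemma branch_extend:
  assumes "deg x = 2" "E x y" "E x z" "y \<noteq> z"
  shows "branch x z = insert x (branch y x)"
proof -
  have "{u. E x u \<and> u \<noteq> z} = {y}"
    using nbrs_deg_2[OF assms] assms(4) by auto
  then show ?thesis using branch_split[OF assms(3)] by simp
qed

text \<open>
  \<open>leg l y x\<close>: the walk that starts in the leaf \<open>l\<close> and goes on through vertices of degree 2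
  traverses the edge from \<open>y\<close> to \<open>x\<close>.
\<close>

inductive leg :: "'a \<Rightarrow> 'a \<Rightarrow> 'a \<Rightarrow> bool" for l where
  leg_start: "deg l = 1 \<Longrightarrow> E l x \<Longrightarrow> leg l l x"
| leg_step: "leg l y x \<Longrightarrow> deg x = 2 \<Longrightarrow> E x z \<Longrightarrow> z \<noteq> y \<Longrightarrow> leg l x z"

lemma leg_edge: "leg l y x \<Longrightarrow> E y x"
  by (induction rule: leg.induct)

lemma leg_leaf: "leg l y x \<Longrightarrow> deg l = 1"
  by (induction rule: leg.induct)

lemma leg_branch:
  "leg l y x \<Longrightarrow> l \<in> branch y x \<and> (\<forall>z\<in>branch y x. z \<noteq> l \<longrightarrow> deg z = 2)"
proof (induction rule: leg.induct)
  case (leg_start x)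
  then show ?case using branch_leaf by auto
next
  case (leg_step y x z)
  have "branch x z = insert x (branch y x)"
    using branch_extend[of x y z] leg_step E_sym leg_edge by blast
  then show ?case using leg_step by auto
qed

lemma leg_branch_deg: "leg l y x \<Longrightarrow> z \<in> branch y x \<Longrightarrow> deg z \<le> 2"
  using leg_branch[of l y x] leg_leaf[of l y x] by (cases "z = l") auto

text \<open>The first walk starts inside \<open>branch y' x'\<close> and can leave it only along the
  edge from \<open>y'\<close> to \<open>x'\<close>, where it stops because
  \<open>deg x' \<noteq> 2\<close>. It must leave, as the branch holds only \<open>l\<close> and
  vertices of degree 2.\<close>

lemma leg_end_unique:
  assumes "leg l y x" "deg x \<noteq> 2" and end': "leg l y' x'" "deg x' \<noteq> 2"
  shows "y = y' \<and> x = x'"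
proof -
  have E': "E y' x'" using leg_edge end' by blast
  have "y \<in> branch y' x' \<and> (x \<in> branch y' x' \<or> y = y' \<and> x = x')"
    using assms(1)
  proof (induction rule: leg.induct)
    case (leg_start x)
    then show ?case using leg_branch[OF end'(1)] branch_boundary[OF E', of l x] by blast
  next
    case (leg_step y x z)
    then show ?case using branch_boundary[OF E', of x z] end'(2) by blast
  qed
  moreover have "x \<notin> branch y' x'"
  proof
    assume "x \<in> branch y' x'"
    then have "x = l" using leg_branch[OF end'(1)] assms(2) by blast
    then show False using leg_branch[OF assms(1)] branch_anchor[OF leg_edge[OF assms(1)]] by blast
  qed
  ultimately show ?thesis by blast
qed

text \<open>An endless walk would have ever larger branches behind its current edge, against the
  finiteness of \<open>V\<close>.\<close>

lemma leg_end_ex: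
  assumes "deg l = 1"
  shows "\<exists>y x. leg l y x \<and> deg x \<noteq> 2"
proof (rule ccontr)
  assume no: "\<nexists>y x. leg l y x \<and> deg x \<noteq> 2"
  have "\<exists>y x. leg l y x \<and> n < card (branch y x)" for n
  proof (induction n)
    case 0
    obtain x where x: "E l x"
      using assms unfolding deg_def by (metis card_1_singletonE insertI1 mem_Collect_eq)
    then have "leg l l x" using leg_start assms by blast
    then show ?case using branch_leaf assms x by fastforce
  next
    case (Suc n)
    then obtain y x where yx: "leg l y x" "n < card (branch y x)" by blast
    have x2: "deg x = 2" using no yx by blast
    have Exy: "E x y" using leg_edge E_sym yx by blast
    obtain z where z: "E x z" "z \<noteq> y"
    proof -
      have "{u. E x u} \<noteq> {y}" using x2 unfolding deg_def by auto
      then show ?thesis using that Exy by blast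
    qed
    have "branch x z = insert x (branch y x)"
      using branch_extend[of x y z] x2 Exy z by blast
    moreover have "x \<notin> branch y x" using branch_anchor[OF leg_edge[OF yx(1)]] .
    ultimately have "Suc n < card (branch x z)" using yx by simp
    then show ?case using leg_step yx(1) x2 z by blast
  qed
  then obtain y x where "card V < card (branch y x)" by blast
  then show False using card_mono[OF finite_V branch_V[of y x]] by simp
qed

text \<open>Converse of \<open>leg_branch_deg\<close>: walking inward from \<open>y\<close>, a
  branch without degrees above 2 loses one vertex per step until a leaf remains; read backwards,
  this is the walk from that leaf.\<close>

lemma leg_ex:
  assumes "E y x" "\<forall>z\<in>branch y x. deg z \<le> 2"
  shows "\<exists>l. leg l y x"
  using assms
proof (induction "card (branch y x)" arbitrary: y x rule: less_induct)
  case less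
  have "0 < deg y" "deg y \<le> 2"
    using less.prems deg_pos branch_self by blast+
  then consider "deg y = 1" | "deg y = 2" by linarith
  then show ?case
  proof cases
    case 1
    then show ?thesis using leg_start less.prems by blast
  next
    case 2
    then have "{u. E y u} \<noteq> {x}" unfolding deg_def by auto
    then obtain w where w: "E y w" "w \<noteq> x" using less.prems by blast
    have br: "branch y x = insert y (branch w y)"
      using branch_extend[of y w x] 2 w less.prems by blast
    have "y \<notin> branch w y" using branch_anchor[of w y] w E_sym by blast
    then have "card (branch w y) < card (branch y x)" using br by simp
    then obtain l where "leg l w y" using less.hyps[of w y] less.prems br w E_sym by blast
    then show ?thesis using leg_step 2 less.prems w by blast
  qed
qed

text \<open>The last edge of the walk that starts in a leaf.\<close>

definition base :: "'a \<Rightarrow> 'a" where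
  "base l = (THE y. \<exists>x. leg l y x \<and> deg x \<noteq> 2)"

definition apex :: "'a \<Rightarrow> 'a" where
  "apex l = (THE x. \<exists>y. leg l y x \<and> deg x \<noteq> 2)"

lemma leg_endI: "leg l y x \<Longrightarrow> deg x \<noteq> 2 \<Longrightarrow> base l = y \<and> apex l = x"
  unfolding base_def apex_def using leg_end_unique by (intro conjI the_equality) blast+

lemma leg_end:
  assumes "deg l = 1"
  shows "leg l (base l) (apex l)" "deg (apex l) \<noteq> 2"
  using leg_end_ex[OF assms] leg_endI by blast+

definition stems :: "'a set" where
  "stems = {x \<in> V. 2 \<le> card {l. deg l = 1 \<and> apex l = x} \<and>
                   (\<exists>l. deg l = 1 \<and> apex l = x \<and> base l = l)}"

text \<open>\<open>base l \<noteq> l\<close> marks a long leg; all long legs at a vertex but the one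
  with the least leaf are chosen. \<open>deg (apex l) = 1\<close> is the case of a path, whose two
  leaves are the apices of each other.\<close>

definition tips :: "'a set" where
  "tips = {l. deg l = 1 \<and>
              (deg (apex l) = 1 \<or>
               base l \<noteq> l \<and> (\<exists>l'<l. deg l' = 1 \<and> apex l' = apex l \<and> base l' \<noteq> l'))}"

lemma stems_V: "stems \<subseteq> V"
  by (auto simp: stems_def)

lemma tips_V: "tips \<subseteq> V"
  using deg_1_V by (auto simp: tips_def)

lemma finite_legs_at [simplified, simp]: "finite {l. deg l = 1 \<and> apex l = x}"
  using finite_V deg_1_V by (metis (mono_tags, lifting) finite_subset mem_Collect_eq subsetI)

text \<open>If both legs are long, the one with the larger leaf is not the first at
  \<open>x\<close>, so its leaf is a tip; if one is short, the two legs make \<open>x\<close> a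
  stem.\<close>

lemma two_legs:
  assumes "leg l y x" "leg l' y' x" "y \<noteq> y'" "deg x \<noteq> 2"
  shows "x \<in> stems \<and> (base l = l \<or> base l' = l') \<or> l \<in> tips \<or> l' \<in> tips"
proof -
  have e: "base l = y" "apex l = x" "base l' = y'" "apex l' = x"
    using leg_endI assms by blast+
  have l: "deg l = 1" "deg l' = 1" using leg_leaf assms by blast+
  have "l \<noteq> l'" using e assms(3) by blast
  show ?thesis
  proof (cases "base l = l \<or> base l' = l'")
    case True
    have "{l, l'} \<subseteq> {l. deg l = 1 \<and> apex l = x}" using e l by blast
    from card_mono[OF _ this] have "2 \<le> card {l. deg l = 1 \<and> apex l = x}"
      using \<open>l \<noteq> l'\<close> by simp
    moreover have "x \<in> V" using leg_edge[OF assms(1)] E_V' by blast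
    ultimately show ?thesis using True e l unfolding stems_def by blast
  next
    case False
    then show ?thesis using e l \<open>l \<noteq> l'\<close> unfolding tips_def by (cases "l < l'") auto
  qed
qed

section \<open>Listeners behind branching vertices\<close>

lemma listener_beyond:
  assumes x: "x \<in> V" "3 \<le> deg x" and c: "c \<in> V"
    and beyond: "\<And>y z. E x y \<Longrightarrow> d y c = Suc (d x c) \<Longrightarrow> z \<in> branch y x \<Longrightarrow> deg z \<le> 2"
  shows "x \<in> stems \<or> (\<exists>y. E x y \<and> d y c = Suc (d x c) \<and> branch y x \<inter> tips \<noteq> {})"
proof -
  \<comment> \<open>The neighbours of \<open>x\<close> on the side away from \<open>c\<close>. At
    most one neighbour is closer to \<open>c\<close>, so degree 3 leaves two of them, and their
    branches are legs to which \<open>two_legs\<close> applies.\<close>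
  define C where "C = {y. E x y \<and> d y c = Suc (d x c)}"
  have fin: "finite C" unfolding C_def by (rule finite_subset[OF _ finite_nbrs[of x]]) blast
  have "2 \<le> card C"
  proof (cases "\<exists>p. E x p \<and> p \<notin> C")
    case True
    then obtain p where p: "E x p" "p \<notin> C" by blast
    then have "d x c = Suc (d p c)" using d_adj[OF p(1) c] C_def by blast
    then have "{u. E x u} - {p} \<subseteq> C" using d_far[OF p(1) _ _ c] C_def by blast
    then have "card ({u. E x u} - {p}) \<le> card C" using fin card_mono by blast
    then show ?thesis using x p by (simp add: deg_def)
  next
    case False
    then have "{u. E x u} \<subseteq> C" by blast
    then have "deg x \<le> card C" using card_mono[OF fin] unfolding deg_def by blast
    then show ?thesis using x by linarith
  qed
  then obtain S where "S \<subseteq> C" "card S = 2" by (metis obtain_subset_with_card_n)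
  then obtain y y' where y: "y \<in> C" "y' \<in> C" "y \<noteq> y'" by (auto simp: card_2_iff)
  then have E: "E y x" "E y' x" using C_def E_sym by blast+
  then obtain l l' where l: "leg l y x" "leg l' y' x"
    using leg_ex[of y x] leg_ex[of y' x] beyond y C_def by blast
  then have "l \<in> branch y x" "l' \<in> branch y' x" using leg_branch by blast+
  then show ?thesis using two_legs[OF l y(3)] x y C_def by auto
qed

lemma farthest_ex:
  assumes "z \<in> S" "S \<subseteq> V" "P z"
  shows "\<exists>x\<in>S. P x \<and> (\<forall>z\<in>S. P z \<longrightarrow> d z c \<le> d x c)"
proof -
  let ?S = "{x \<in> S. P x}"
  have fin: "finite ?S" using finite_subset[OF assms(2) finite_V] by simp
  have "Max ((\<lambda>x. d x c) ` ?S) \<in> (\<lambda>x. d x c) ` ?S" using fin assms by (intro Max_in) auto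
  then obtain x where "x \<in> ?S" "d x c = Max ((\<lambda>x. d x c) ` ?S)" by auto
  then show ?thesis using fin by (intro bexI[of _ x]) auto
qed

lemma beyond_dist:
  assumes "E x y" "c \<in> V" "d y c = Suc (d x c)" "z \<in> branch y x"
  shows "d z c = d z x + d x c" "0 < d z x"
proof -
  have V: "x \<in> V" "y \<in> V" "z \<in> V" using assms E_V E_V' branch_V by blast+
  have "c \<notin> branch y x"
    using assms(3) d_sym[of y c] d_sym[of x c] V assms(2) by (simp add: branch_def)
  then show "d z c = d z x + d x c"
    using branch_dist[of y x z c] assms E_sym by blast
  show "0 < d z x" using assms(4) by (simp add: branch_def)
qed

text \<open>For a vertex \<open>x\<close> of degree at least 3 in the branch that is farthest from
  \<open>c\<close>, the branches at \<open>x\<close> pointing away from \<open>c\<close> have only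
  degrees at most 2, so they are legs.\<close>

lemma branching_listener:
  assumes ac: "E a c" and z: "z \<in> branch a c" "3 \<le> deg z"
  shows "branch a c \<inter> (stems \<union> tips) \<noteq> {}"
proof -
  have V: "a \<in> V" "c \<in> V" using ac E_V E_V' by blast+
  obtain x where x: "x \<in> branch a c" "3 \<le> deg x"
    and max: "\<And>z. z \<in> branch a c \<Longrightarrow> 3 \<le> deg z \<Longrightarrow> d z c \<le> d x c"
    using farthest_ex[where P = "\<lambda>z. 3 \<le> deg z" and c = c, OF z(1) branch_V z(2)] by blast
  have xV: "x \<in> V" using x branch_V by blast
  \<comment> \<open>Otherwise the path from \<open>x\<close> to \<open>z\<close> would pass through
    \<open>c\<close>, although \<open>z\<close> lies beyond \<open>x\<close> as seen from
    \<open>c\<close>.\<close>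
  have sub: "branch y x \<subseteq> branch a c" if y: "E x y" "d y c = Suc (d x c)" for y
  proof
    fix z assume z: "z \<in> branch y x"
    have zV: "z \<in> V" using z branch_V by blast
    show "z \<in> branch a c"
    proof (rule ccontr)
      assume "z \<notin> branch a c"
      then have "d x z = d x c + d c z" using branch_dist[OF ac x(1) zV] by blast
      then show False
        using beyond_dist[OF y(1) V(2) y(2) z] branch_d[OF ac x(1)]
          d_sym[OF xV zV] d_sym[OF zV V(2)] by linarith
    qed
  qed
  have "deg z \<le> 2" if "E x y" "d y c = Suc (d x c)" "z \<in> branch y x" for y z
    using beyond_dist[OF that(1) V(2) that(2,3)] max[of z] sub[OF that(1,2)] that(3) by force
  then show ?thesis
    using listener_beyond[OF xV x(2) V(2)] sub x(1) by blast
qed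

text \<open>Without degrees above 2 each leg ends in the opposite leaf, so the first alternative of
  \<open>tips\<close> applies.\<close>

lemma path_tip:
  assumes "E a c" "\<forall>z\<in>V. deg z \<le> 2"
  shows "branch a c \<inter> tips \<noteq> {}"
proof -
  obtain l where l: "leg l a c" using leg_ex[OF assms(1)] assms(2) branch_V by blast
  then have l1: "deg l = 1" using leg_leaf by blast
  have e: "leg l (base l) (apex l)" "deg (apex l) \<noteq> 2" using leg_end[OF l1] .
  have "E (base l) (apex l)" using leg_edge e by blast
  then have "0 < deg (apex l)" "apex l \<in> V" using deg_pos E_sym E_V' by blast+
  then have "deg (apex l) = 1" using e(2) assms(2) by fastforce
  then have "l \<in> tips" using l1 by (simp add: tips_def)
  then show ?thesis using leg_branch[OF l] by blast
qed

text \<open>One listener anywhere suffices for the parity argument in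
  \<open>stems_tips_resolving\<close>. A vertex of degree at least 3 farthest from \<open>u\<close>
  has two legs; without such a vertex the tree is a path.\<close>

lemma listener_ex:
  assumes "u \<in> V" "v \<in> V" "u \<noteq> v"
  shows "stems \<union> tips \<noteq> {}"
proof -
  obtain w where w: "E u w" using closer_ex assms by blast
  show ?thesis
  proof (cases "\<exists>z\<in>V. 3 \<le> deg z")
    case True
    then obtain x where x: "x \<in> V" "3 \<le> deg x"
      and max: "\<And>z. z \<in> V \<Longrightarrow> 3 \<le> deg z \<Longrightarrow> d z u \<le> d x u"
      using farthest_ex[where S = V and P = "\<lambda>z. 3 \<le> deg z" and c = u] by blast
    have "deg z \<le> 2" if "E x y" "d y u = Suc (d x u)" "z \<in> branch y x" for y z
      using beyond_dist[OF that(1) assms(1) that(2,3)] max[of z] that(3) branch_V by force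
    then show ?thesis using listener_beyond[OF x assms(1)] by blast
  next
    case False
    then have "\<forall>z\<in>V. deg z \<le> 2" by fastforce
    then show ?thesis using path_tip w by blast
  qed
qed

section \<open>Stems and tips resolve the tree\<close>

definition dom :: "'a set \<Rightarrow> 'a \<Rightarrow> bool" where
  "dom W u \<longleftrightarrow> (\<exists>w\<in>W. u = w \<or> E w u)"

text \<open>Being distinguished is a condition on pairs of vertices and symmetric in them, so this
  is the requirement in \<open>detection_pair\<close>; see
  \<open>detection_pair_iff_resolving\<close>.\<close>

definition resolving :: "'a set \<Rightarrow> 'a set \<Rightarrow> bool" where
  "resolving W L \<longleftrightarrow>
     (\<forall>u\<in>V. \<forall>v\<in>V. u \<noteq> v \<longrightarrow> dom W u \<or> dom W v \<or> (\<exists>l\<in>L. d u l \<noteq> d v l))"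

lemma stems_tips_resolving: "resolving stems (stems \<union> tips)"
  unfolding resolving_def
proof (intro ballI impI, rule ccontr)
  fix u v assume V: "u \<in> V" "v \<in> V" and "u \<noteq> v"
    and "\<not> (dom stems u \<or> dom stems v \<or> (\<exists>l\<in>stems \<union> tips. d u l \<noteq> d v l))"
  then have nd: "\<not> dom stems u" "\<not> dom stems v"
    and eq: "\<And>l. l \<in> stems \<union> tips \<Longrightarrow> d u l = d v l" by blast+
  \<comment> \<open>This listener has the same distance to \<open>u\<close> and \<open>v\<close>, so
    parity provides the midpoint \<open>c\<close>.\<close>
  obtain l where l: "l \<in> stems \<union> tips" using listener_ex[OF V \<open>u \<noteq> v\<close>] by blast
  have "even (d u v)"
    using d_parity[of u v l] eq[OF l] V l stems_V tips_V by auto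
  then obtain h where h: "d u v = 2 * h" by blast
  then have "0 < h" using d_0_iff V \<open>u \<noteq> v\<close> by fastforce
  obtain c where c: "c \<in> V" "d u c = h" "d c v = h"
    using between_ex[OF V, of h] h by auto
  have "u \<noteq> c" "v \<noteq> c" using c \<open>0 < h\<close> V by auto
  then obtain a b where a: "E c a" "u \<in> branch a c" and b: "E c b" "v \<in> branch b c"
    using branch_cover V c(1) by blast
  have ac: "E a c" "a \<in> V" and bc: "E b c" "b \<in> V" using a b E_sym E_V' by blast+
  have ua: "h = Suc (d u a)" and vb: "h = Suc (d v b)"
    using branch_d[OF ac(1) a(2)] branch_d[OF bc(1) b(2)] c d_sym[OF V(2) c(1)] by auto
  have "a \<noteq> b"
    using d_triangle[OF V(1) ac(2) V(2)] d_sym[OF V(2) ac(2)] ua vb h \<open>0 < h\<close> by auto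
  then have disj: "branch a c \<inter> branch b c = {}" using branch_disjoint a b by blast
  \<comment> \<open>A listener behind \<open>a'\<close> is reached from \<open>v'\<close> only
    through \<open>c\<close>, but from \<open>u'\<close> without the detour from \<open>a'\<close>
    to \<open>c\<close>; as both are at distance \<open>h\<close> from \<open>c\<close>, it would be
    strictly nearer to \<open>u'\<close>.\<close>
  have empty: "branch a' c \<inter> (stems \<union> tips) = {}"
    if a': "E a' c" "u' \<in> branch a' c" "v' \<in> V" "v' \<notin> branch a' c" "d v' c = h" "h = Suc (d u' a')"
      and eq': "\<And>l. l \<in> stems \<union> tips \<Longrightarrow> d u' l = d v' l" for a' u' v'
  proof (intro equals0I)
    fix l assume l: "l \<in> branch a' c \<inter> (stems \<union> tips)"
    have V': "l \<in> V" "a' \<in> V" "u' \<in> V" using l a' branch_V E_V by blast+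
    have "d l v' = d l c + d c v'" using branch_dist a' l by blast
    moreover have "d u' l \<le> d u' a' + d a' l" using d_triangle V' by blast
    moreover have "d l c = Suc (d l a')" using branch_d a' l by blast
    ultimately show False
      using eq'[of l] l a' d_sym[OF V'(1) a'(3)] d_sym[OF c(1) a'(3)] d_sym[OF V'(1,2)] by auto
  qed
  have ea: "branch a c \<inter> (stems \<union> tips) = {}"
    using empty[of a u v] ac a ua eq c V b disj d_sym[OF V(2) c(1)] by auto
  have eb: "branch b c \<inter> (stems \<union> tips) = {}"
    using empty[of b v u] bc b vb eq c V a disj by force
  have degs: "\<forall>z\<in>branch a c. deg z \<le> 2" "\<forall>z\<in>branch b c. deg z \<le> 2"
    using branching_listener[OF ac(1)] branching_listener[OF bc(1)] ea eb by force+
  obtain l1 l2 where l12: "leg l1 a c" "leg l2 b c"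
    using leg_ex[OF ac(1) degs(1)] leg_ex[OF bc(1) degs(2)] by blast
  show False
  proof (cases "deg c = 2")
    \<comment> \<open>No leg ends at a vertex of degree 2. Here the two legs cover everything but
      \<open>c\<close>, so the tree is a path, and on a path every branch has a tip.\<close>
    case True
    have "w \<in> {a, b}" if "E c w" for w
      using nbrs_deg_2[OF True a(1) b(1) \<open>a \<noteq> b\<close>] that by blast
    then have "V \<subseteq> insert c (branch a c \<union> branch b c)"
      using branch_cover[OF _ c(1)] by blast
    then have "\<forall>z\<in>V. deg z \<le> 2" using True degs by auto
    then show False using path_tip[OF ac(1)] ea by blast
  next
    case False
    have "l1 \<notin> tips" "l2 \<notin> tips" using leg_branch l12 ea eb by blast+
    then have st: "c \<in> stems" "base l1 = l1 \<or> base l2 = l2"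
      using two_legs[OF l12 \<open>a \<noteq> b\<close> False] by auto
    have "base l1 = a" "base l2 = b" using leg_endI l12 False by blast+
    \<comment> \<open>A short leg is the single vertex \<open>a\<close> or \<open>b\<close>, so
      \<open>u\<close> or \<open>v\<close> is adjacent to the stem \<open>c\<close> and
      dominated.\<close>
    then have "u = a \<or> v = b"
      using st(2) branch_leaf[of a c] branch_leaf[of b c] leg_leaf l12 ac bc a b by auto
    then show False using st(1) a b nd unfolding dom_def by blast
  qed
qed

end

section \<open>The lower bound\<close>

lemma card_eq_sum_fibres:
  assumes "finite A" "finite X" "f ` A \<subseteq> X"
  shows "card A = (\<Sum>x\<in>X. card {a \<in> A. f a = x})"
  using sum.group[OF assms, of "\<lambda>_. 1::nat"] by simp

context metric_tree
begin

abbreviation leaves :: "'a set" where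
  "leaves \<equiv> {l. deg l = 1}"

abbreviation hand :: "'a \<Rightarrow> 'a set" where
  "hand l \<equiv> branch (base l) (apex l)"

lemma finite_leaves [simplified, simp]: "finite {l. deg l = 1}"
  using finite_V deg_1_V by (metis (mono_tags, lifting) finite_subset mem_Collect_eq subsetI)

lemma leaf_hand:
  assumes "deg l = 1"
  shows "E (base l) (apex l)" "l \<in> hand l" "apex l \<notin> hand l" "apex l \<in> V" "0 < deg (apex l)"
proof -
  note e = leg_end[OF assms]
  show E: "E (base l) (apex l)" using leg_edge e by blast
  show "l \<in> hand l" using leg_branch e by blast
  show "apex l \<notin> hand l" using branch_anchor E by blast
  show "apex l \<in> V" "0 < deg (apex l)" using E E_V' E_sym deg_pos by blast+
qed

lemma hand_deg: "deg l = 1 \<Longrightarrow> z \<in> hand l \<Longrightarrow> deg z \<le> 2"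
  using leg_branch_deg leg_end by blast

text \<open>Apices of degree at least 3 lie outside every hand, so \<open>branches_disjoint\<close>
  applies; and a hand determines its leaf, the only vertex in it of degree other than 2.\<close>

lemma hands_disjoint:
  assumes "deg l = 1" "deg l' = 1" "l \<noteq> l'" "3 \<le> deg (apex l)" "3 \<le> deg (apex l')"
  shows "hand l \<inter> hand l' = {}"
proof (rule branches_disjoint)
  show "E (base l) (apex l)" "E (base l') (apex l')" using leaf_hand assms by blast+
  show "apex l \<notin> hand l'" "apex l' \<notin> hand l"
    using hand_deg[OF assms(1), of "apex l'"] hand_deg[OF assms(2), of "apex l"] assms by auto
  show "(base l, apex l) \<noteq> (base l', apex l')"
  proof
    assume "(base l, apex l) = (base l', apex l')"
    then have "l' \<in> hand l" using leaf_hand(2)[OF assms(2)] by simp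
    then show False using leg_branch[OF leg_end(1)[OF assms(1)]] assms by auto
  qed
qed

text \<open>The apex has degree other than 2, hence 1, so beyond the last edge of the leg there is
  only this second leaf.\<close>

lemma path_leaves:
  assumes l: "deg l = 1" and apex: "\<not> 3 \<le> deg (apex l)"
  shows "V = insert (apex l) (hand l)" "leaves = {l, apex l}"
proof -
  note h = leaf_hand[OF l] and e = leg_end[OF l]
  have t: "deg (apex l) = 1" using e(2) h(5) apex by linarith
  have "branch (apex l) (base l) = {apex l}" using branch_leaf t E_sym h(1) by blast
  then show V: "V = insert (apex l) (hand l)"
    using branch_compl[OF h(1)] h(4) branch_V by blast
  show "leaves = {l, apex l}"
  proof (intro set_eqI iffI)
    fix z assume z: "z \<in> leaves"
    then have "z \<in> insert (apex l) (hand l)" using deg_1_V V by blast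
    then show "z \<in> {l, apex l}" using leg_branch[OF e(1)] z by auto
  qed (use l t in auto)
qed

text \<open>Pays for all climbing of the program. Disjoint hands give factor 1; factor 2 is due to
  the path, with its two leaves.\<close>

lemma card_hands: "(\<Sum>l\<in>leaves. card (hand l)) \<le> 2 * card V"
proof (cases "\<forall>l\<in>leaves. 3 \<le> deg (apex l)")
  case True
  have "(\<Sum>l\<in>leaves. card (hand l)) = card (\<Union>l\<in>leaves. hand l)"
    using True hands_disjoint by (intro card_UN_disjoint[symmetric]) auto
  also have "\<dots> \<le> card V" using finite_V branch_V by (intro card_mono) auto
  finally show ?thesis by simp
next
  case False
  then obtain l where l: "deg l = 1" "\<not> 3 \<le> deg (apex l)" by blast
  have "(\<Sum>l\<in>leaves. card (hand l)) \<le> card leaves * card V"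
    using sum_bounded_above[of leaves "\<lambda>l. card (hand l)" "card V"] card_mono[OF finite_V branch_V]
    by simp
  also have "card leaves \<le> 2" using path_leaves(2)[OF l] by (simp add: card_insert_if)
  finally show ?thesis by simp
qed

text \<open>An edge is determined by its lower endpoint in the tree rooted at \<open>r\<close>.\<close>

lemma card_edges: "card {(u, v). E u v} \<le> 2 * card V"
proof (cases "V = {}")
  case True
  then have "{(u, v). E u v} = {}" using E_V by blast
  then show ?thesis by simp
next
  case False
  then obtain r where r: "r \<in> V" by blast
  \<comment> \<open>The Boolean tells whether the arc points towards \<open>r\<close>, so a lower
    endpoint accounts for at most two arcs.\<close>
  let ?f = "\<lambda>(u, v). if d v r < d u r then (u, True) else (v, False)"
  have "inj_on ?f {(u, v). E u v}"
  proof (intro inj_onI, clarify)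
    fix u v u' v'
    assume *: "E u v" "E u' v'"
      "(if d v r < d u r then (u, True) else (v, False)) =
       (if d v' r < d u' r then (u', True) else (v', False))"
    have "d v r \<noteq> d u r" "d v' r \<noteq> d u' r" using d_adj[of _ _ r] * r by fastforce+
    then show "u = u' \<and> v = v'"
      using * closer_unique[of u v v' r] closer_unique[OF E_sym[OF *(1)], of u' r]
        E_sym[OF *(2)] r by (auto split: if_splits)
  qed
  moreover have "?f ` {(u, v). E u v} \<subseteq> V \<times> UNIV"
    using E_V E_V' by (auto split: if_splits)
  ultimately have "card {(u, v). E u v} \<le> card (V \<times> (UNIV :: bool set))"
    using finite_V by (meson card_inj_on_le finite_SigmaI finite)
  then show ?thesis by (simp add: card_cartesian_product)
qed

text \<open>Otherwise two unhit legs contain undominated \<open>z\<close> and \<open>z'\<close> at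
  equal distance \<open>i\<close> from \<open>x\<close>; every listener lies outside both hands and
  sees them through \<open>x\<close>, hence at equal distances.\<close>

lemma unhit_legs:
  assumes res: "resolving W L" and LV: "L \<subseteq> V"
    and l: "deg l = 1" "apex l = x" and l': "deg l' = 1" "apex l' = x" and "l \<noteq> l'"
    and x: "3 \<le> deg x"
    and unhit: "hand l \<inter> (W \<union> L) = {}" "hand l' \<inter> (W \<union> L) = {}"
  shows "x \<in> W \<and> (base l = l \<or> base l' = l')"
proof (rule ccontr)
  assume no: "\<not> (x \<in> W \<and> (base l = l \<or> base l' = l'))"
  have E: "E (base l) x" "E (base l') x"
    using leaf_hand(1)[OF l(1)] leaf_hand(1)[OF l'(1)] by (simp_all only: l l')
  have disj: "hand l \<inter> hand l' = {}" using hands_disjoint[of l l'] l l' x \<open>l \<noteq> l'\<close> by simp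
  \<comment> \<open>If \<open>x\<close> is no watcher, \<open>i = 1\<close> selects the first vertex
    of a leg. The second one, \<open>i = 2\<close>, exists on a long leg and is out of reach even of
    a watcher on \<open>x\<close>.\<close>
  have pick: "\<exists>z\<in>hand k. d z x = i \<and> \<not> dom W z"
    if k: "deg k = 1" "apex k = x" "hand k \<inter> (W \<union> L) = {}"
      and i: "i = 1 \<and> x \<notin> W \<or> i = 2 \<and> base k \<noteq> k" for k i
  proof -
    have Ek: "E (base k) x" using leaf_hand(1)[OF k(1)] k(2) by simp
    have hk: "hand k = branch (base k) x" by (simp only: k(2))
    have dom: "w = x \<and> z = base k" if "z \<in> hand k" "w \<in> W" "E w z" for z w
    proof -
      have "w \<notin> branch (base k) x" using k(3) that(2) unfolding hk by blast
      then show ?thesis using branch_boundary[OF Ek _ E_sym[OF that(3)]] that(1) unfolding hk by blast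
    qed
    have bk: "base k \<in> hand k" "d (base k) x = 1"
      using branch_self[OF Ek] d_edge[OF Ek] by (simp_all only: hk)
    show ?thesis
    proof (cases "i = 1 \<and> x \<notin> W")
      case True
      then show ?thesis using bk dom[OF bk(1)] k(3) unfolding dom_def by blast
    next
      case False
      then have i2: "i = 2" "base k \<noteq> k" using i by blast+
      have "deg (base k) = 2" using leg_branch[OF leg_end(1)[OF k(1)]] bk i2 by blast
      then have "{u. E (base k) u} \<noteq> {x}" unfolding deg_def by auto
      then obtain z where z: "E (base k) z" "z \<noteq> x" using Ek by blast
      have zk: "z \<in> hand k" using branch_boundary[OF Ek, of "base k" z] bk z unfolding hk by blast
      have "d z x = Suc (d z (base k))" using branch_d[OF Ek] zk unfolding hk by blast
      moreover have "d z (base k) = 1" using d_edge[OF E_sym[OF z(1)]] .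
      ultimately have "d z x = i" using i2 by simp
      moreover have "\<not> dom W z"
        using zk k(3) dom[OF zk] z(1) E_irrefl[of z] unfolding dom_def by blast
      ultimately show ?thesis using zk by blast
    qed
  qed
  obtain i where i: "i = 1 \<and> x \<notin> W \<or> i = (2::nat) \<and> base l \<noteq> l \<and> base l' \<noteq> l'"
    using no by blast
  obtain z z' where z: "z \<in> hand l" "d z x = i" "\<not> dom W z"
    and z': "z' \<in> hand l'" "d z' x = i" "\<not> dom W z'"
    using pick[OF l unhit(1), of i] pick[OF l' unhit(2), of i] i by blast
  have "z \<noteq> z'" using z z' disj by blast
  then obtain k where k: "k \<in> L" "d z k \<noteq> d z' k"
    using res z z' branch_V unfolding resolving_def by blast
  have "k \<in> V" "k \<notin> hand l" "k \<notin> hand l'" using k LV unhit by blast+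
  then have "d z k = d z x + d x k" "d z' k = d z' x + d x k"
    using branch_dist[OF E(1)] branch_dist[OF E(2)] z(1) z'(1) unfolding l(2) l'(2) by blast+
  then show False using k(2) z(2) z'(2) by simp
qed

text \<open>A stem counts twice, for its watcher and its listener. The right side is twice what the
  given pair is charged at \<open>x\<close>: one for each hit leg and one for a watcher on
  \<open>x\<close>.\<close>

lemma local_cost:
  assumes res: "resolving W L" and LV: "L \<subseteq> V" and x: "3 \<le> deg x"
  shows "2 * of_bool (x \<in> stems) + card {l \<in> tips. apex l = x}
    \<le> 2 * (card {l \<in> {l \<in> leaves. hand l \<inter> (W \<union> L) \<noteq> {}}. apex l = x} + of_bool (x \<in> W))"
proof -
  define K where "K = {l. deg l = 1 \<and> apex l = x}"
  define S where "S = {l \<in> K. base l = l}"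
  define M where "M = {l \<in> K. base l \<noteq> l}"
  define H where "H = {l \<in> K. hand l \<inter> (W \<union> L) \<noteq> {}}"
  have fin: "finite K" "finite S" "finite M" "finite H"
    unfolding S_def M_def H_def using finite_legs_at[of x] unfolding K_def by simp_all
  have K: "card K = card S + card M"
  proof -
    have "K = S \<union> M" "S \<inter> M = {}" by (auto simp: S_def M_def)
    then show ?thesis using card_Un_disjoint fin by metis
  qed
  have tips: "card {l \<in> tips. apex l = x} \<le> card M - 1"
  proof (cases "M = {}")
    case True
    then have "{l \<in> tips. apex l = x} = {}" using x by (auto simp: tips_def M_def K_def)
    then show ?thesis by (simp only: card.empty)
  next
    case False
    \<comment> \<open>The least leaf of a long leg at \<open>x\<close> has no smaller rival, so it
      is not a tip.\<close>
    have "{l \<in> tips. apex l = x} \<subseteq> M - {Min M}"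
    proof
      fix l assume "l \<in> {l \<in> tips. apex l = x}"
      then obtain l' where "l \<in> M" "l' \<in> M" "l' < l"
        using x by (auto simp: tips_def M_def K_def)
      then show "l \<in> M - {Min M}" using Min_le[OF fin(3), of l'] by auto
    qed
    then have "card {l \<in> tips. apex l = x} \<le> card (M - {Min M})" using fin card_mono by blast
    then show ?thesis using False fin by simp
  qed
  have stems: "2 \<le> card K \<and> 1 \<le> card S" if "x \<in> stems"
  proof -
    have "S \<noteq> {}" using that by (auto simp: stems_def S_def K_def)
    then show ?thesis
      using that fin by (auto simp: stems_def K_def card_gt_0_iff Suc_le_eq)
  qed
  have unhit: "x \<in> W \<and> (l \<in> S \<or> l' \<in> S)" if "l \<in> K - H" "l' \<in> K - H" "l \<noteq> l'" for l l'
    using unhit_legs[OF res LV, of l x l'] that x by (auto simp: K_def H_def S_def)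
  have H: "card K - 1 \<le> card H" if "x \<notin> W"
  proof -
    have "card (K - H) \<le> 1"
      using unhit that fin by (auto simp: card_le_Suc0_iff_eq)
    then show ?thesis using diff_card_le_card_Diff[OF fin(4), of K] by linarith
  qed
  have HM: "card M - 1 \<le> card H"
  proof -
    have "l = l'" if "l \<in> M - H" "l' \<in> M - H" for l l'
      using unhit[of l l'] that by (auto simp: M_def S_def)
    then have "card (M - H) \<le> 1"
      using fin by (auto simp: card_le_Suc0_iff_eq)
    then show ?thesis using diff_card_le_card_Diff[OF fin(4), of M] by linarith
  qed
  have "{l \<in> {l \<in> leaves. hand l \<inter> (W \<union> L) \<noteq> {}}. apex l = x} = H"
    by (auto simp: H_def K_def)
  then have eq: "card {l \<in> {l \<in> leaves. hand l \<inter> (W \<union> L) \<noteq> {}}. apex l = x} = card H"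
    by (simp only:)
  \<comment> \<open>For a stem outside \<open>W\<close>, \<open>card H\<close> is at least 1 and at
    least \<open>card M\<close>, as one leg is short; this covers \<open>2 + (card M - 1)\<close>.
    For \<open>x\<close> in \<open>W\<close>, the watcher pays the 2. Truncated subtraction takes
    care of empty \<open>M\<close>.\<close>
  have "2 * of_bool (x \<in> stems) + (card M - 1) \<le> 2 * (card H + of_bool (x \<in> W))"
    using stems K H HM by (cases "x \<in> stems"; cases "x \<in> W") auto
  then show ?thesis unfolding eq using tips by linarith
qed

text \<open>Sums \<open>local_cost\<close> over the branching vertices. One chosen element per hit
  hand and the watchers in \<open>X\<close> are distinct elements of \<open>W \<union> L\<close>, so
  nothing is charged twice. The path is separate: its apices are leaves, and its hands may overlap.
  A single vertex has no leaf and falls under the first case.\<close>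

theorem stems_tips_cost:
  assumes res: "resolving W L" and WV: "W \<subseteq> V" and LV: "L \<subseteq> V"
  shows "card stems + card (stems \<union> tips) \<le> 2 * (card W + card L)"
proof (cases "\<forall>l\<in>leaves. 3 \<le> deg (apex l)")
  case True
  define X where "X = {x \<in> V. 3 \<le> deg x}"
  define H where "H = {l \<in> leaves. hand l \<inter> (W \<union> L) \<noteq> {}}"
  have fin: "finite X" "finite H" "finite tips" "finite W" "finite L"
    using finite_V tips_V WV LV finite_subset by (auto simp: X_def H_def)
  have topX: "apex l \<in> X" if "deg l = 1" for l
    using that True leaf_hand by (simp add: X_def)
  have stX: "stems \<subseteq> X" using topX by (auto simp: stems_def)
  have "\<forall>l\<in>H. \<exists>h. h \<in> hand l \<inter> (W \<union> L)" by (auto simp: H_def)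
  then obtain h where h: "\<And>l. l \<in> H \<Longrightarrow> h l \<in> hand l \<inter> (W \<union> L)" by metis
  have inj: "inj_on h H"
  proof (intro inj_onI)
    fix l l' assume l: "l \<in> H" "l' \<in> H" "h l = h l'"
    then have "hand l \<inter> hand l' \<noteq> {}" using h by (metis IntD1 IntI empty_iff)
    then show "l = l'" using hands_disjoint[of l l'] l True by (auto simp: H_def)
  qed
  have "h l \<notin> X" if "l \<in> H" for l
    using h[OF that] hand_deg[of l "h l"] that by (auto simp: H_def X_def)
  then have disj: "h ` H \<inter> (X \<inter> W) = {}" by blast
  have "card H + card (X \<inter> W) = card (h ` H \<union> X \<inter> W)"
    using disj inj fin by (simp add: card_Un_disjoint card_image)
  also have "\<dots> \<le> card (W \<union> L)" using h fin by (intro card_mono) auto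
  also have "\<dots> \<le> card W + card L" by (rule card_Un_le)
  finally have lower: "card H + card (X \<inter> W) \<le> card W + card L" .
  have indicator: "card (X \<inter> A) = (\<Sum>x\<in>X. of_bool (x \<in> A))" for A
    using fin by (simp add: Int_def sum.If_cases of_bool_def)
  have "apex ` tips \<subseteq> X" "apex ` H \<subseteq> X" using topX by (auto simp: tips_def H_def)
  then have fibres: "card tips = (\<Sum>x\<in>X. card {l \<in> tips. apex l = x})"
    "card H = (\<Sum>x\<in>X. card {l \<in> H. apex l = x})"
    using card_eq_sum_fibres fin by blast+
  have "card stems + card (stems \<union> tips) \<le> 2 * card (X \<inter> stems) + card tips"
    using card_Un_le[of stems tips] stX by (simp add: Int_absorb1)
  also have "\<dots> = (\<Sum>x\<in>X. 2 * of_bool (x \<in> stems) + card {l \<in> tips. apex l = x})"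
    unfolding indicator fibres(1) by (simp only: sum.distrib sum_distrib_left)
  also have "\<dots> \<le> (\<Sum>x\<in>X. 2 * (card {l \<in> H. apex l = x} + of_bool (x \<in> W)))"
    using local_cost[OF res LV] unfolding H_def by (intro sum_mono) (simp add: X_def)
  also have "\<dots> = 2 * (card H + card (X \<inter> W))"
    unfolding indicator fibres(2) by (simp only: sum.distrib sum_distrib_left distrib_left)
  also have "\<dots> \<le> 2 * (card W + card L)" using lower by (rule mult_le_mono2)
  finally show ?thesis .
next
  case False
  then obtain l where l: "deg l = 1" "\<not> 3 \<le> deg (apex l)" by blast
  note p = path_leaves[OF l] and h = leaf_hand[OF l(1)]
  have "apex l \<noteq> l" using h by metis
  \<comment> \<open>A leg never ends in its own leaf, so each of the two leaves is the apex of at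
    most one leg.\<close>
  have "stems = {}"
  proof (rule ccontr)
    assume "stems \<noteq> {}"
    then obtain x k where x: "2 \<le> card {l. deg l = 1 \<and> apex l = x}" "deg k = 1" "apex k = x" "x \<in> V"
      by (auto simp: stems_def)
    have "deg x \<noteq> 2" using leg_end x by blast
    moreover have "deg z = 2" if "z \<in> hand l" "z \<noteq> l" for z
      using leg_branch[OF leg_end(1)[OF l(1)]] that by blast
    ultimately have "x \<in> {l, apex l}" using x(4) p(1) by blast
    moreover have "apex x \<noteq> x" if "deg x = 1" using leaf_hand[OF that] by metis
    ultimately have "{l. deg l = 1 \<and> apex l = x} \<subseteq> {l, apex l} - {x}" using p(2) by blast
    then have "card {l. deg l = 1 \<and> apex l = x} \<le> card ({l, apex l} - {x})" by (intro card_mono) auto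
    also have "\<dots> \<le> 1" using \<open>x \<in> {l, apex l}\<close> \<open>apex l \<noteq> l\<close> by auto
    finally show False using x(1) by simp
  qed
  moreover have "card tips \<le> 2"
  proof -
    have "tips \<subseteq> {l, apex l}" using p(2) by (auto simp: tips_def)
    then have "card tips \<le> card {l, apex l}" by (intro card_mono) auto
    then show ?thesis using \<open>apex l \<noteq> l\<close> by simp
  qed
  moreover have "1 \<le> card W + card L"
  proof (rule ccontr)
    assume "\<not> 1 \<le> card W + card L"
    then have "card W = 0" "card L = 0" by simp_all
    then have "W = {}" "L = {}"
      using finite_subset[OF WV finite_V] finite_subset[OF LV finite_V] by simp_all
    then show False
      using res h \<open>apex l \<noteq> l\<close> deg_1_V[OF l(1)] unfolding resolving_def dom_def by blast
  qed
  ultimately show ?thesis by simp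
qed

end

section \<open>Undirected trees\<close>

text \<open>Agrees with \<open>gdist\<close> between vertices joined by a walk; numbers in place of
  \<open>ereal\<close> suit the metric locale.\<close>

definition dist_nat :: "'a pair_pre_digraph \<Rightarrow> 'a \<Rightarrow> 'a \<Rightarrow> nat" where
  "dist_nat G u v = (LEAST n. \<exists>p. pre_digraph.awalk (with_proj G) u p v \<and> length p = n)"

lemma pawalk_verts_snoc:
  "pcas w q v \<Longrightarrow> pawalk_verts w (q @ [(v, u)]) = pawalk_verts w q @ [u]"
  by (induction w q v rule: pcas.induct) auto

context pair_graph
begin

lemma dist_nat_le: "awalk u p v \<Longrightarrow> dist_nat G u v \<le> length p"
  unfolding dist_nat_def by (rule Least_le) blast

lemma dist_nat_walk: "awalk u p v \<Longrightarrow> \<exists>q. awalk u q v \<and> length q = dist_nat G u v"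
  unfolding dist_nat_def by (rule LeastI_ex) blast

lemma awalk_rev: "awalk u p v \<Longrightarrow> awalk v (rev (map prod.swap p)) u"
proof (induction p arbitrary: u)
  case Nil
  then show ?case by (auto simp: awalk_Nil_iff)
next
  case (Cons e p)
  then have e: "e \<in> parcs G" "u = fst e" and p: "awalk (snd e) p v"
    by (auto simp: awalk_Cons_iff)
  have "prod.swap e \<in> parcs G"
    using e(1) graph_symmetric[of "fst e" "snd e"] by (simp add: prod.swap_def)
  then have "awalk (snd e) [prod.swap e] u"
    using e in_arcsD1[of "fst e" "snd e"] in_arcsD2[of "fst e" "snd e"]
    by (simp add: awalk_Cons_iff awalk_Nil_iff)
  then show ?case using awalk_appendI[OF Cons.IH[OF p]] by simp
qed

lemma gdist_dist_nat:
  assumes "awalk u p v"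
  shows "gdist G u v = ereal (real (dist_nat G u v))"
proof -
  have cost: "awalk_cost (\<lambda>_. 1) q = real (length q)" for q :: "('a \<times> 'a) list"
    by (induction q) auto
  obtain q where q: "awalk u q v" "length q = dist_nat G u v"
    using dist_nat_walk[OF assms] by blast
  show ?thesis
    unfolding gdist_def \<mu>_def
  proof (rule antisym)
    show "(INF p\<in>{p. awalk u p v}. ereal (awalk_cost (\<lambda>_. 1) p)) \<le> ereal (real (dist_nat G u v))"
      using q by (intro INF_lower2[of q]) (auto simp: cost)
    show "ereal (real (dist_nat G u v)) \<le> (INF p\<in>{p. awalk u p v}. ereal (awalk_cost (\<lambda>_. 1) p))"
      using dist_nat_le by (intro INF_greatest) (auto simp: cost)
  qed
qed

text \<open>The rest of the walk from \<open>u\<close> on would be shorter than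
  \<open>dist_nat G w r\<close>, hence shorter than \<open>dist_nat G u r\<close>.\<close>

lemma closer_walk_avoids:
  assumes "awalk w p r" "length p = dist_nat G w r" "dist_nat G w r \<le> dist_nat G u r" "u \<noteq> w"
  shows "u \<notin> set (pawalk_verts w p)"
proof
  assume "u \<in> set (pawalk_verts w p)"
  then obtain q s where qs: "p = q @ s" "awalk w q u" "awalk u s r"
    using awalk_decomp[OF assms(1)] by blast
  then have "q \<noteq> []" using assms(4) by (auto simp: awalk_Nil_iff)
  then show False using dist_nat_le[OF qs(3)] qs(1) assms(2,3) by (cases q) auto
qed

end

lemma undirected_tree_walk:
  assumes "undirected_tree G" "u \<in> pverts G" "v \<in> pverts G"
  shows "\<exists>p. pre_digraph.awalk (with_proj G) u p v"
proof -
  interpret pair_graph G using assms by (simp add: undirected_tree_def)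
  have "strongly_connected (with_proj G)"
    using assms(1) symmetric_connected_imp_strongly_connected sym_arcs
    by (simp add: undirected_tree_def)
  then have "u \<rightarrow>\<^sup>*\<^bsub>with_proj G\<^esub> v" using assms by (simp add: strongly_connected_def)
  then show ?thesis by (simp add: reachable_awalk)
qed

text \<open>Acyclicity enters in \<open>closer_unique\<close>: if two neighbours of \<open>u\<close>
  are no farther from \<open>r\<close> than \<open>u\<close>, their shortest walks to
  \<open>r\<close> avoid \<open>u\<close>; joined and shortened to a path, they close up through
  \<open>u\<close> to a cycle.\<close>

lemma undirected_tree_metric_tree:
  fixes G :: "'a::linorder pair_pre_digraph"
  assumes "undirected_tree G"
  shows "metric_tree (pverts G) (\<lambda>u v. (u, v) \<in> parcs G) (dist_nat G)"
    (is "metric_tree ?V ?E ?d")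
proof -
  interpret pair_graph G using assms by (simp add: undirected_tree_def)
  have acyclic: "\<nexists>p. cycle p \<and> 3 \<le> length p"
    using assms by (simp add: undirected_tree_def)
  have walk: "\<exists>p. awalk u p v \<and> length p = ?d u v" if "u \<in> ?V" "v \<in> ?V" for u v
    using undirected_tree_walk[OF assms that] dist_nat_walk by blast
  have sym: "?E u v \<Longrightarrow> ?E v u" for u v using graph_symmetric by blast
  have step: "?d u r \<le> Suc (?d w r)" if uw: "?E u w" and r: "r \<in> ?V" for u w r
  proof -
    obtain p where "awalk w p r" "length p = ?d w r" using walk in_arcsD2 uw r by blast
    then show ?thesis using dist_nat_le[of u "(u, w) # p" r] uw by (simp add: awalk_Cons_iff)
  qed
  show ?thesis
  proof
    show "finite ?V" by (rule pair_finite_verts)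
  next
    fix u v assume "?E u v"
    then show "u \<in> ?V" "?E v u" using in_arcsD1 sym by blast+
  next
    fix u show "(u, u) \<notin> parcs G" using pair_no_loops[of "(u, u)"] by auto
  next
    fix u v assume uv: "u \<in> ?V" "v \<in> ?V"
    show "?d u v = 0 \<longleftrightarrow> u = v"
      using walk[OF uv] dist_nat_le[of u "[]" v] uv by (auto simp: awalk_Nil_iff)
    have "?d v u \<le> ?d u v" if V: "u \<in> ?V" "v \<in> ?V" for u v
    proof -
      obtain p where p: "awalk u p v" "length p = ?d u v" using walk[OF V] by blast
      show ?thesis using dist_nat_le[OF awalk_rev[OF p(1)]] p(2) by simp
    qed
    then show "?d u v = ?d v u" using uv by (simp add: antisym)
  next
    fix u w r assume "?E u w" "r \<in> ?V"
    then show "?d w r \<le> Suc (?d u r)" using step sym by blast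
  next
    fix u r assume *: "u \<in> ?V" "r \<in> ?V" "u \<noteq> r"
    then obtain p where p: "awalk u p r" "length p = ?d u r" using walk by blast
    then obtain e q where e: "p = e # q" using * by (cases p) (auto simp: awalk_Nil_iff)
    then have "?E u (snd e)" "awalk (snd e) q r" using p by (auto simp: awalk_Cons_iff)
    moreover have "?d u r = Suc (?d (snd e) r)"
      using dist_nat_le[OF calculation(2)] step[OF calculation(1) *(2)] p(2) e by simp
    ultimately show "\<exists>w. ?E u w \<and> ?d u r = Suc (?d w r)" by blast
  next
    fix u w w' r
    assume E: "?E u w" "?E u w'" and "w \<noteq> w'" and r: "r \<in> ?V" and le: "?d w r \<le> ?d u r"
    show "?d u r < ?d w' r"
    proof (rule ccontr)
      assume "\<not> ?d u r < ?d w' r"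
      then have le': "?d w' r \<le> ?d u r" by simp
      have ne: "u \<noteq> w" "u \<noteq> w'" using E pair_no_loops by fastforce+
      obtain p where p: "awalk w p r" "length p = ?d w r"
        using walk[OF in_arcsD2[OF E(1)] r] by blast
      obtain p' where p': "awalk w' p' r" "length p' = ?d w' r"
        using walk[OF in_arcsD2[OF E(2)] r] by blast
      have avoid: "u \<notin> set (pawalk_verts w p)" "u \<notin> set (pawalk_verts w' p')"
        using closer_walk_avoids[OF p le ne(1)] closer_walk_avoids[OF p' le' ne(2)] .
      let ?q = "p @ rev (map prod.swap p')"
      have walk_q: "awalk w ?q w'" using awalk_appendI[OF p(1) awalk_rev[OF p'(1)]] .
      \<comment> \<open>Shortening keeps a subset of the arcs, so the path still avoids
        \<open>u\<close>.\<close>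
      define q where "q = awalk_to_apath ?q"
      have q: "apath w q w'" "set q \<subseteq> set ?q"
        unfolding q_def using apath_awalk_to_apath[OF walk_q] awalk_to_apath_subset[OF walk_q] .
      have walk': "awalk w q w'" using q(1) awalkI_apath by blast
      have "u \<notin> set (pawalk_verts w ?q)"
        using avoid ne unfolding set_awalk_verts[OF walk_q] set_awalk_verts[OF p(1)]
          set_awalk_verts[OF p'(1)] by (force simp: image_iff)
      then have u: "u \<notin> set (pawalk_verts w q)"
        using image_mono[OF q(2), of fst] image_mono[OF q(2), of snd]
        unfolding set_awalk_verts[OF walk_q] set_awalk_verts[OF walk'] set_map by blast
      let ?c = "(u, w) # q @ [(w', u)]"
      have "awalk u ?c u"
        using E sym[OF E(2)] walk' in_arcsD1[OF E(1)]
        by (auto simp: awalk_Cons_iff awalk_Nil_iff intro!: awalk_appendI)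
      moreover have "pawalk_verts w (q @ [(w', u)]) = pawalk_verts w q @ [u]"
        using walk' by (intro pawalk_verts_snoc) (simp add: awalk_def)
      then have "distinct (tl (pawalk_verts u ?c))"
        using q(1) u by (simp add: apath_def)
      \<comment> \<open>With the two arcs at \<open>u\<close> the length is at least 3, so this is a
        genuine undirected cycle.\<close>
      moreover have "q \<noteq> []" using walk' \<open>w \<noteq> w'\<close> by (auto simp: awalk_Nil_iff)
      then have "3 \<le> length ?c" by (cases q) auto
      ultimately show False using acyclic unfolding cycle_def by blast
    qed
  qed
qed

text \<open>All distances in a tree are finite, so comparing \<open>gdist\<close> amounts to
  comparing \<open>dist_nat\<close>.\<close>

lemma detection_pair_iff_resolving:
  fixes T :: "'a::linorder pair_pre_digraph"
  assumes tree: "undirected_tree T"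
  shows "detection_pair T W L \<longleftrightarrow> W \<subseteq> pverts T \<and> L \<subseteq> pverts T \<and>
    metric_tree.resolving (pverts T) (\<lambda>u v. (u, v) \<in> parcs T) (dist_nat T) W L"
proof -
  interpret pair_graph T using tree by (simp add: undirected_tree_def)
  interpret mt: metric_tree "pverts T" "\<lambda>u v. (u, v) \<in> parcs T" "dist_nat T"
    by (rule undirected_tree_metric_tree[OF tree])
  have dom: "dominated T W u = mt.dom W u" for u
    by (simp add: dominated_def mt.dom_def)
  have dist: "gdist T u v = ereal (real (dist_nat T u v))" if "u \<in> pverts T" "v \<in> pverts T" for u v
    using undirected_tree_walk[OF tree that] gdist_dist_nat by blast
  have sep: "separates T l u v \<longleftrightarrow> dist_nat T u l \<noteq> dist_nat T v l"
    if "l \<in> pverts T" "u \<in> pverts T" "v \<in> pverts T" for l u v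
    using that by (simp add: separates_def dist)
  have "(\<exists>l\<in>L. separates T l u v) \<longleftrightarrow> (\<exists>l\<in>L. dist_nat T u l \<noteq> dist_nat T v l)"
    if "L \<subseteq> pverts T" "u \<in> pverts T" "v \<in> pverts T" for u v
    using sep that by (intro bex_cong) auto
  then show ?thesis
    unfolding detection_pair_def distinguished_def mt.resolving_def dom by (auto 4 3)
qed

section \<open>The program\<close>

primrec loopfree :: "com \<Rightarrow> bool" where
  "loopfree Skip \<longleftrightarrow> True"
| "loopfree (Assign x e) \<longleftrightarrow> True"
| "loopfree (Write a i e) \<longleftrightarrow> True"
| "loopfree (Seq p q) \<longleftrightarrow> loopfree p \<and> loopfree q"
| "loopfree (If b p q) \<longleftrightarrow> loopfree p \<and> loopfree q"
| "loopfree (While b p) \<longleftrightarrow> False"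

text \<open>With \<open>time\<close> and \<open>fits\<close> it lets simplification replace
  derivations of \<open>exec\<close>; all three are meant for programs that satisfy
  \<open>loopfree\<close>.\<close>

primrec run :: "com \<Rightarrow> state \<Rightarrow> state" where
  "run Skip s = s"
| "run (Assign x e) s = s\<lparr>reg := (reg s)(x := aval s e)\<rparr>"
| "run (Write a i e) s = s\<lparr>mem := (mem s)(a := (mem s a)(aval s i := aval s e))\<rparr>"
| "run (Seq p q) s = run q (run p s)"
| "run (If b p q) s = (if bval s b then run p s else run q s)"
| "run (While b p) s = s"

primrec time :: "com \<Rightarrow> nat" where
  "time Skip = 1"
| "time (Assign x e) = 1 + acost e"
| "time (Write a i e) = 1 + acost i + acost e"
| "time (Seq p q) = time p + time q"
| "time (If b p q) = 1 + bcost b + max (time p) (time q)"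
| "time (While b p) = 0"

primrec fits :: "nat \<Rightarrow> com \<Rightarrow> state \<Rightarrow> bool" where
  "fits B Skip s \<longleftrightarrow> True"
| "fits B (Assign x e) s \<longleftrightarrow> afits B s e"
| "fits B (Write a i e) s \<longleftrightarrow> afits B s i \<and> afits B s e"
| "fits B (Seq p q) s \<longleftrightarrow> fits B p s \<and> fits B q (run p s)"
| "fits B (If b p q) s \<longleftrightarrow> bfits B s b \<and> (if bval s b then fits B p s else fits B q s)"
| "fits B (While b p) s \<longleftrightarrow> True"

lemma exec_loopfree:
  "loopfree p \<Longrightarrow> fits B p s \<Longrightarrow> \<exists>t\<le>time p. exec B p s t (run p s)"
proof (induction p arbitrary: s)
  case Skip
  then show ?case using exec.Skip[of B s] by auto
next
  case (Assign x e)
  then show ?case using exec.Assign[of B s e x] by auto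
next
  case (Write a i e)
  then show ?case using exec.Write[of B s i e a] by auto
next
  case (Seq p q)
  obtain t where t: "t \<le> time p" "exec B p s t (run p s)"
    using Seq.IH(1)[of s] Seq.prems by auto
  obtain t' where "t' \<le> time q" "exec B q (run p s) t' (run q (run p s))"
    using Seq.IH(2)[of "run p s"] Seq.prems by auto
  then show ?case using exec.Seq[OF t(2)] t(1) by (intro exI[of _ "t + t'"]) auto
next
  case (If b p q)
  show ?case
  proof (cases "bval s b")
    case True
    then obtain t where "t \<le> time p" "exec B p s t (run p s)"
      using If.IH(1)[of s] If.prems by auto
    then show ?thesis
      using exec.IfTrue[of B s b p t "run p s" q] True If.prems
      by (intro exI[of _ "1 + bcost b + t"]) auto
  next
    case False
    then obtain t where "t \<le> time q" "exec B q s t (run q s)"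
      using If.IH(2)[of s] If.prems by auto
    then show ?thesis
      using exec.IfFalse[of B s b q t "run q s" p] False If.prems
      by (intro exI[of _ "1 + bcost b + t"]) auto
  qed
qed simp

text \<open>The potential \<open>\<phi>\<close> bounds the remaining running time.\<close>

lemma exec_while:
  assumes fits: "\<And>s. I s \<Longrightarrow> bfits B s b"
    and body: "\<And>s. I s \<Longrightarrow> bval s b \<Longrightarrow>
      \<exists>t s'. exec B p s t s' \<and> I s' \<and> 1 + bcost b + t + \<phi> s' \<le> \<phi> s"
    and exit: "\<And>s. I s \<Longrightarrow> 1 + bcost b \<le> \<phi> s"
    and "I s"
  shows "\<exists>t s'. exec B (While b p) s t s' \<and> I s' \<and> \<not> bval s' b \<and> t \<le> \<phi> s"
  using \<open>I s\<close>
proof (induction "\<phi> s" arbitrary: s rule: less_induct)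
  case less
  show ?case
  proof (cases "bval s b")
    case True
    then obtain t s' where 1: "exec B p s t s'" "I s'" "1 + bcost b + t + \<phi> s' \<le> \<phi> s"
      using body less.prems by blast
    then obtain t' s'' where
      2: "exec B (While b p) s' t' s''" "I s''" "\<not> bval s'' b" "t' \<le> \<phi> s'"
      using less.hyps[of s'] by auto
    then show ?thesis
      using exec.WhileTrue[OF fits[OF less.prems] True 1(1) 2(1)] 1(3) by fastforce
  next
    case False
    then show ?thesis
      using exec.WhileFalse[OF fits[OF less.prems]] exit[OF less.prems] less.prems by blast
  qed
qed

section \<open>The algorithm\<close>

definition degree :: "aexp \<Rightarrow> aexp" where
  "degree e = Minus (Read ''off'' (Plus e (N 1))) (Read ''off'' e)"

text \<open>
  At a vertex \<open>x\<close> of degree 2, the neighbour other than \<open>y\<close> is the sum of both neighbours minus \<open>y\<close>.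
\<close>

definition climb_step :: com where
  "climb_step =
     Seq (Assign ''z'' (Minus (Plus (Read ''adj'' (Read ''off'' (V ''x'')))
                                    (Read ''adj'' (Plus (Read ''off'' (V ''x'')) (N 1))))
                              (V ''y'')))
    (Seq (Assign ''y'' (V ''x''))
         (Assign ''x'' (V ''z'')))"

definition climb_test :: bexp where
  "climb_test = Eq (degree (V ''x'')) (N 2)"

definition enter :: com where
  "enter =
     Seq (Assign ''y'' (V ''i''))
         (Assign ''x'' (Read ''adj'' (Read ''off'' (V ''i''))))"

text \<open>Runs with \<open>y = base i\<close> and \<open>x = apex i\<close>. The flag
  \<open>long\<close> records that a long leg at \<open>x\<close> was seen before; as leaves come in
  increasing order, the leg without listener is that of the least leaf, as in \<open>tips\<close>.
  The last conditional treats the path.\<close>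

definition note_leg :: com where
  "note_leg =
     Seq (Write ''count'' (V ''x'') (Plus (Read ''count'' (V ''x'')) (N 1)))
    (Seq (If (Eq (V ''y'') (V ''i''))
             (Write ''short'' (V ''x'') (N 1))
             (If (Eq (Read ''long'' (V ''x'')) (N 0))
                 (Write ''long'' (V ''x'') (N 1))
                 (Write ''L'' (V ''i'') (N 1))))
         (If (Eq (degree (V ''x'')) (N 1)) (Write ''L'' (V ''i'') (N 1)) Skip))"

definition incr :: com where
  "incr = Assign ''i'' (Plus (V ''i'') (N 1))"

definition visit_test :: bexp where
  "visit_test = Eq (degree (V ''i'')) (N 1)"

definition visit :: com where
  "visit = If visit_test
     (Seq enter (Seq (While climb_test climb_step) note_leg)) Skip"

text \<open>Needs the count over all leaves, hence a second pass.\<close>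

definition mark :: com where
  "mark = If (And (Less (N 1) (Read ''count'' (V ''i''))) (Eq (Read ''short'' (V ''i'')) (N 1)))
     (Seq (Write ''W'' (V ''i'') (N 1)) (Write ''L'' (V ''i'') (N 1))) Skip"

definition scan_test :: bexp where
  "scan_test = Less (V ''i'') (V ''n'')"

definition detect :: com where
  "detect =
     Seq (While scan_test (Seq visit incr))
    (Seq (Assign ''i'' (N 0))
         (While scan_test (Seq mark incr)))"

section \<open>Adjacency lists and the climb along a leg\<close>

locale adjacency_tree = metric_tree V E d
  for V :: "nat set" and E and d +
  fixes xs :: "nat list list"
  assumes V_eq: "V = {..<length xs}"
    and adj: "\<And>v. v < length xs \<Longrightarrow> distinct (xs ! v) \<and> set (xs ! v) = {u. E v u}"
    and nonempty: "xs \<noteq> []"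
begin

abbreviation "n \<equiv> length xs"
abbreviation "off \<equiv> mem (input_state xs) ''off''"
abbreviation "nbr \<equiv> mem (input_state xs) ''adj''"

lemma deg_length: "v < n \<Longrightarrow> deg v = length (xs ! v)"
  using adj[of v] distinct_card[of "xs ! v"] by (simp add: deg_def)

lemma off_Suc: "v < n \<Longrightarrow> off (Suc v) = off v + deg v"
  by (simp add: input_state_def take_Suc_conv_app_nth deg_length)

text \<open>Degrees add up to the number of arcs, which \<open>card_edges\<close> bounds; this keeps
  offsets within words linear in \<open>n\<close>.\<close>

lemma length_concat: "length (concat xs) \<le> 2 * n"
proof -
  have "length (concat xs) = (\<Sum>v<n. length (xs ! v))"
    by (simp add: length_concat sum_list_sum_nth atLeast0LessThan)
  also have "\<dots> = (\<Sum>v\<in>V. card {u. E v u})"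
    using deg_length by (simp add: V_eq deg_def)
  also have "\<dots> = card (SIGMA v:V. {u. E v u})"
    using finite_V by (simp add: card_SigmaI)
  also have "(SIGMA v:V. {u. E v u}) = {(v, u). E v u}" using E_V by auto
  finally show ?thesis using card_edges by (simp add: V_eq)
qed

lemma off_le: "off v \<le> 2 * n"
proof -
  have "length (concat (take v xs)) \<le> length (concat xs)"
    by (metis append_take_drop_id concat_append le_add1 length_append)
  then show ?thesis using length_concat by (auto simp: input_state_def)
qed

lemma nbr_nth:
  assumes "v < n" "j < deg v"
  shows "nbr (off v + j) = xs ! v ! j"
proof -
  have j: "j < length (xs ! v)" using assms deg_length by simp
  have "concat xs = concat (take v xs) @ xs ! v @ concat (drop (Suc v) xs)"
    using id_take_nth_drop[OF assms(1)] by (metis concat.simps(2) concat_append)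
  then show ?thesis using assms(1) j by (simp add: input_state_def nth_append)
qed

lemma nbr_E:
  assumes "v < n" "j < deg v"
  shows "E v (nbr (off v + j))"
  using adj[OF assms(1)] nbr_nth[OF assms] deg_length[OF assms(1)] assms(2)
  by (metis mem_Collect_eq nth_mem)

lemma E_less: "E u v \<Longrightarrow> u < n \<and> v < n"
  using E_V E_V' V_eq by auto

text \<open>\<open>y\<close> is one of the two neighbours, so the truncated subtraction is exact.
  The sum is bounded because it occurs as an intermediate word.\<close>

lemma next_nbr:
  assumes "deg x = 2" "E x y"
  shows "E x (nbr (off x) + nbr (Suc (off x)) - y)" "nbr (off x) + nbr (Suc (off x)) - y \<noteq> y"
    "nbr (off x) + nbr (Suc (off x)) \<le> 2 * n"
proof -
  have x: "x < n" using E_less assms by blast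
  obtain p q where pq: "xs ! x = [p, q]"
    using deg_length[OF x] assms(1) by (metis One_nat_def Suc_1 length_0_conv length_Suc_conv)
  have nb: "nbr (off x) = p" "nbr (Suc (off x)) = q"
    using nbr_nth[OF x, of 0] nbr_nth[OF x, of 1] assms(1) pq by simp_all
  have "p \<noteq> q" "{u. E x u} = {p, q}" using adj[OF x] pq by auto
  then have E: "E x p" "E x q" "y = p \<or> y = q" using assms(2) by blast+
  then have "p < n" "q < n" using E_less by blast+
  then show "E x (nbr (off x) + nbr (Suc (off x)) - y)"
    "nbr (off x) + nbr (Suc (off x)) - y \<noteq> y" "nbr (off x) + nbr (Suc (off x)) \<le> 2 * n"
    unfolding nb using E \<open>p \<noteq> q\<close> by auto
qed

lemma leg_less: "leg l y x \<Longrightarrow> y < n \<and> x < n"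
  using E_less leg_edge by blast

text \<open>The walk cannot cross the last edge early, since it continues only from vertices of
  degree 2. This bounds the rounds of the climb by \<open>card (hand l)\<close>.\<close>

lemma leg_sub_hand:
  assumes "leg l y x"
  shows "branch y x \<subseteq> hand l"
proof -
  have l: "deg l = 1" using leg_leaf assms by blast
  show ?thesis
    using assms
  proof (induction rule: leg.induct)
    case (leg_start x)
    then show ?case using branch_leaf[of l x] leaf_hand(2)[OF l] by simp
  next
    case (leg_step y x z)
    have "E y x" using leg_edge leg_step by blast
    have "y \<in> hand l" using branch_self[OF \<open>E y x\<close>] leg_step by blast
    then have "x \<in> hand l"
      using branch_boundary[OF leaf_hand(1)[OF l] _ \<open>E y x\<close>] leg_end(2)[OF l] leg_step by blast
    then show ?case
      using branch_extend[of x y z] leg_step E_sym[OF \<open>E y x\<close>] by simp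
  qed
qed

context
  fixes B :: nat
  assumes B: "10 * n \<le> B"
begin

text \<open>Offsets and sums of two neighbours are at most \<open>2 * n\<close>, and the constants
  of the program at most 2, so words up to \<open>10 * n\<close> with positive \<open>n\<close>
  leave ample room.\<close>

lemma B_pos: "10 \<le> B"
  using B nonempty by (cases xs) auto

lemma off_B: "off v \<le> B"
  using off_le[of v] B by linarith

lemma less_B: "v < n \<Longrightarrow> Suc v \<le> B"
  using B by linarith

lemma climb_exec:
  assumes m: "mem s ''off'' = off" "mem s ''adj'' = nbr"
    and l: "leg (reg s ''i'') (reg s ''y'') (reg s ''x'')"
  shows "\<exists>t s'. exec B (While climb_test climb_step) s t s' \<and> mem s' = mem s \<and>
    reg s' ''i'' = reg s ''i'' \<and> reg s' ''n'' = reg s ''n'' \<and>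
    reg s' ''y'' = base (reg s ''i'') \<and> reg s' ''x'' = apex (reg s ''i'') \<and>
    t \<le> 1 + bcost climb_test + (1 + bcost climb_test + time climb_step) * card (hand (reg s ''i''))"
proof -
  define l where "l = reg s ''i''"
  define K where "K = 1 + bcost climb_test + time climb_step"
  \<comment> \<open>Each round costs at most \<open>K\<close> and enlarges the branch behind the
    current edge by one vertex within \<open>hand l\<close>.\<close>
  define \<phi> where "\<phi> s = 1 + bcost climb_test +
      K * (card (hand l) - card (branch (reg s ''y'') (reg s ''x'')))" for s :: state
  define I where "I s' \<longleftrightarrow> mem s' = mem s \<and> reg s' ''i'' = l \<and> reg s' ''n'' = reg s ''n'' \<and>
      leg l (reg s' ''y'') (reg s' ''x'')" for s' :: state
  have "\<exists>t s'. exec B (While climb_test climb_step) s t s' \<and> I s' \<and> \<not> bval s' climb_test \<and> t \<le> \<phi> s"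
  proof (rule exec_while)
    fix s' assume s': "I s'"
    then have lt: "reg s' ''x'' < n" using leg_less by (auto simp: I_def)
    show "bfits B s' climb_test"
      using s' m lt off_B less_B[OF lt] B_pos by (simp add: I_def climb_test_def degree_def)
    show "1 + bcost climb_test \<le> \<phi> s'" by (simp add: \<phi>_def)
    assume b: "bval s' climb_test"
    define x y where "x = reg s' ''x''" and "y = reg s' ''y''"
    define z where "z = nbr (off x) + nbr (Suc (off x)) - y"
    have leg: "leg l y x" using s' by (simp add: I_def x_def y_def)
    have x: "x < n" "y < n" using leg_less leg by blast+
    have deg: "deg x = 2"
      using b s' m off_Suc[OF x(1)] by (simp add: climb_test_def degree_def I_def x_def)
    have Exy: "E x y" using leg leg_edge E_sym by blast
    have z: "E x z" "z \<noteq> y" and sum: "nbr (off x) + nbr (Suc (off x)) \<le> 2 * n"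
      using next_nbr[OF deg Exy] by (simp_all add: z_def)
    have leg': "leg l x z" using leg_step leg deg z by blast
    have le: "nbr (off x) \<le> B" "nbr (Suc (off x)) \<le> B" "nbr (off x) + nbr (Suc (off x)) \<le> B"
      "Suc (off x) \<le> B" "z \<le> B"
      using sum B off_le[of x] B_pos unfolding z_def by linarith+
    have "fits B climb_step s'"
      using s' m le off_B less_B[OF x(1)] less_B[OF x(2)] B_pos
      by (simp add: climb_step_def I_def flip: x_def y_def z_def)
    then obtain t where t: "t \<le> time climb_step" "exec B climb_step s' t (run climb_step s')"
      using exec_loopfree[of climb_step B s'] by (auto simp: climb_step_def)
    have I': "I (run climb_step s')" and xy': "reg (run climb_step s') ''x'' = z"
      "reg (run climb_step s') ''y'' = x"
      using s' m leg' by (simp_all add: climb_step_def I_def flip: x_def y_def z_def)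
    have br: "branch x z = insert x (branch y x)" using branch_extend[OF deg Exy z(1)] z(2) by blast
    have "x \<notin> branch y x" using branch_anchor leg_edge leg by blast
    then have "card (branch x z) = Suc (card (branch y x))" using br by simp
    moreover have "card (branch x z) \<le> card (hand l)"
      using leg_sub_hand[OF leg'] card_mono finite_branch by blast
    ultimately have
      "K + K * (card (hand l) - card (branch x z)) = K * (card (hand l) - card (branch y x))"
      by (metis Suc_diff_Suc Suc_le_lessD diff_Suc_Suc mult_Suc_right)
    then have "1 + bcost climb_test + t + \<phi> (run climb_step s') \<le> \<phi> s'"
      using t(1) unfolding \<phi>_def xy' x_def[symmetric] y_def[symmetric] by (simp add: K_def)
    then show "\<exists>t s''. exec B climb_step s' t s'' \<and> I s'' \<and> 1 + bcost climb_test + t + \<phi> s'' \<le> \<phi> s'"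
      using t(2) I' by blast
  next
    show "I s" using l by (simp add: I_def l_def)
  qed
  then obtain t s' where ts: "exec B (While climb_test climb_step) s t s'" "I s'"
    "\<not> bval s' climb_test" "t \<le> \<phi> s" by blast
  have leg: "leg l (reg s' ''y'') (reg s' ''x'')" using ts(2) by (simp add: I_def)
  then have "deg (reg s' ''x'') \<noteq> 2"
    using ts(2,3) m off_Suc[of "reg s' ''x''"] leg_less[OF leg]
    by (simp add: climb_test_def degree_def I_def)
  then have "base l = reg s' ''y'' \<and> apex l = reg s' ''x''" using leg_endI leg by blast
  moreover have "\<phi> s \<le> 1 + bcost climb_test + K * card (hand l)" by (simp add: \<phi>_def)
  ultimately show ?thesis
    using ts by (intro exI[of _ t] exI[of _ s']) (auto simp: I_def l_def K_def)
qed

end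

end

section \<open>Running time and output\<close>

definition visit_time :: nat where
  "visit_time = time (If visit_test enter Skip) +
     (1 + bcost climb_test) + time (Seq note_leg incr)"

definition climb_time :: nat where
  "climb_time = 1 + bcost climb_test + time climb_step"

text \<open>The summand 10 makes \<open>detect_time * n\<close> a sufficient word bound. One-time
  costs, such as the last test of a loop, are charged to every vertex, as \<open>n\<close> is
  positive; \<open>2 * climb_time\<close> comes from \<open>card_hands\<close>.\<close>

definition detect_time :: nat where
  "detect_time = 10 + (2 * (1 + bcost scan_test) + visit_time + 2 * climb_time) +
     time (Assign ''i'' (N 0)) + (2 * (1 + bcost scan_test) + time (Seq mark incr))"

section \<open>Loop invariants and amortised running time\<close>

context adjacency_tree
begin

text \<open>\<open>tally\<close>, \<open>shorts\<close> and \<open>longs\<close> describe the arrays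
  \<open>count\<close>, \<open>short\<close> and \<open>long\<close> once the vertices below
  \<open>i\<close> are visited.\<close>

definition tally :: "nat \<Rightarrow> nat \<Rightarrow> nat" where
  "tally i x = card {l. l < i \<and> deg l = 1 \<and> apex l = x}"

definition shorts :: "nat \<Rightarrow> nat \<Rightarrow> bool" where
  "shorts i x \<longleftrightarrow> (\<exists>l<i. deg l = 1 \<and> apex l = x \<and> base l = l)"

definition longs :: "nat \<Rightarrow> nat \<Rightarrow> bool" where
  "longs i x \<longleftrightarrow> (\<exists>l<i. deg l = 1 \<and> apex l = x \<and> base l \<noteq> l)"

lemma tally_Suc: "tally (Suc i) x = tally i x + of_bool (deg i = 1 \<and> apex i = x)"
proof -
  have "{l. l < Suc i \<and> deg l = 1 \<and> apex l = x} =
      {l. l < i \<and> deg l = 1 \<and> apex l = x} \<union> (if deg i = 1 \<and> apex i = x then {i} else {})"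
    by (auto simp: less_Suc_eq)
  then show ?thesis unfolding tally_def by (simp add: card_insert_if)
qed

lemma shorts_Suc: "shorts (Suc i) x \<longleftrightarrow> shorts i x \<or> deg i = 1 \<and> apex i = x \<and> base i = i"
  by (auto simp: shorts_def less_Suc_eq)

lemma longs_Suc: "longs (Suc i) x \<longleftrightarrow> longs i x \<or> deg i = 1 \<and> apex i = x \<and> base i \<noteq> i"
  by (auto simp: longs_def less_Suc_eq)

lemma tally_le: "tally i x \<le> i"
proof -
  have "tally i x \<le> card {..<i}" unfolding tally_def by (intro card_mono) auto
  then show ?thesis by simp
qed

text \<open>Among the other leaves only smaller ones matter, so \<open>note_leg\<close> can decide
  about \<open>i\<close> at its visit.\<close>

lemma tips_iff:
  "i \<in> tips \<longleftrightarrow> deg i = 1 \<and> (deg (apex i) = 1 \<or> base i \<noteq> i \<and> longs i (apex i))"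
  by (auto simp: tips_def longs_def)

lemma stems_iff: "x \<in> stems \<longleftrightarrow> 1 < tally n x \<and> shorts n x"
proof -
  have less: "l < n" if "deg l = 1" for l using deg_1_V[OF that] V_eq by simp
  then have eq: "{l. l < n \<and> deg l = 1 \<and> apex l = x} = {l. deg l = 1 \<and> apex l = x}" by blast
  have sh: "shorts n x \<longleftrightarrow> (\<exists>l. deg l = 1 \<and> apex l = x \<and> base l = l)"
    using less unfolding shorts_def by blast
  have "x \<in> V" if "\<exists>l. deg l = 1 \<and> apex l = x \<and> base l = l" using that leaf_hand(4) by blast
  moreover have "2 \<le> k \<longleftrightarrow> 1 < k" for k :: nat by auto
  ultimately show ?thesis unfolding stems_def tally_def mem_Collect_eq eq sh by blast
qed

definition scanned :: "nat \<Rightarrow> state \<Rightarrow> bool" where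
  "scanned i s \<longleftrightarrow> i \<le> n \<and> reg s ''i'' = i \<and> reg s ''n'' = n \<and>
     mem s ''off'' = off \<and> mem s ''adj'' = nbr \<and> mem s ''count'' = tally i \<and>
     mem s ''short'' = (\<lambda>x. of_bool (shorts i x)) \<and>
     mem s ''long'' = (\<lambda>x. of_bool (longs i x)) \<and>
     mem s ''L'' = (\<lambda>x. of_bool (x < i \<and> x \<in> tips)) \<and> mem s ''W'' = (\<lambda>_. 0)"

definition marked :: "nat \<Rightarrow> state \<Rightarrow> bool" where
  "marked i s \<longleftrightarrow> i \<le> n \<and> reg s ''i'' = i \<and> reg s ''n'' = n \<and> mem s ''count'' = tally n \<and>
     mem s ''short'' = (\<lambda>x. of_bool (shorts n x)) \<and>
     mem s ''L'' = (\<lambda>x. of_bool (x \<in> tips \<or> x < i \<and> x \<in> stems)) \<and>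
     mem s ''W'' = (\<lambda>x. of_bool (x < i \<and> x \<in> stems))"

context
  fixes B :: nat
  assumes B: "10 * n \<le> B"
begin

lemma note_leg_exec:
  assumes s: "scanned i s" "i < n" "deg i = 1" "reg s ''y'' = base i" "reg s ''x'' = apex i"
  shows "\<exists>t s'. exec B (Seq note_leg incr) s t s' \<and> scanned (Suc i) s' \<and>
    t \<le> time (Seq note_leg incr)"
proof -
  have less: "base i < n" "apex i < n"
    using leg_less leg_end(1)[OF s(3)] by blast+
  have le: "off v \<le> B" for v using off_B[OF B] .
  have small: "v < n \<Longrightarrow> v \<le> B \<and> Suc v \<le> B" for v using less_B[OF B, of v] by simp
  have cnt: "tally i v \<le> B \<and> Suc (tally i v) \<le> B" for v
    using tally_le[of i v] s(2) B by linarith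
  have deg: "off (Suc (apex i)) - off (apex i) = deg (apex i)" using off_Suc less by simp
  have "fits B (Seq note_leg incr) s"
    using s small[OF less(1)] small[OF less(2)] small[OF s(2)] le cnt B_pos[OF B]
    by (simp add: note_leg_def incr_def degree_def scanned_def)
  then obtain t where t: "t \<le> time (Seq note_leg incr)"
    "exec B (Seq note_leg incr) s t (run (Seq note_leg incr) s)"
    using exec_loopfree[of "Seq note_leg incr" B s] by (auto simp: note_leg_def incr_def)
  have "scanned (Suc i) (run (Seq note_leg incr) s)"
    using s deg unfolding scanned_def note_leg_def incr_def degree_def
    by (auto simp: fun_eq_iff tally_Suc shorts_Suc longs_Suc tips_iff[of i] less_Suc_eq)
  then show ?thesis using t by blast
qed

lemma visit_exec:
  assumes s: "scanned i s" "i < n"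
  shows "\<exists>t s'. exec B (Seq visit incr) s t s' \<and> scanned (Suc i) s' \<and>
    t \<le> visit_time + climb_time * (if deg i = 1 then card (hand i) else 0)"
proof -
  have le: "off v \<le> B" for v using off_B[OF B] .
  have small: "v < n \<Longrightarrow> v \<le> B \<and> Suc v \<le> B" for v using less_B[OF B, of v] by simp
  have fits: "bfits B s visit_test"
    using s le small[OF s(2)] B_pos[OF B] by (simp add: visit_test_def degree_def scanned_def)
  have bval: "bval s visit_test \<longleftrightarrow> deg i = 1"
    using s off_Suc[OF s(2)] by (simp add: visit_test_def degree_def scanned_def)
  show ?thesis
  proof (cases "deg i = 1")
    case False
    have "exec B visit s (1 + bcost visit_test + 1) s"
      unfolding visit_def using fits bval False by (intro exec.IfFalse exec.Skip) auto
    moreover have "fits B incr s"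
      using s small[OF s(2)] B_pos[OF B] by (simp add: incr_def scanned_def)
    then obtain t where t: "t \<le> time incr" "exec B incr s t (run incr s)"
      using exec_loopfree[of incr B s] by (auto simp: incr_def)
    moreover have "scanned (Suc i) (run incr s)"
      using s False unfolding scanned_def incr_def
      by (auto simp: fun_eq_iff tally_Suc shorts_Suc longs_Suc tips_iff[of i] less_Suc_eq)
    moreover have "1 + bcost visit_test + 1 + t \<le> visit_time"
      using t(1) by (simp add: visit_time_def)
    ultimately show ?thesis
      using exec.Seq[of B visit s _ s incr t] by (meson trans_le_add1)
  next
    case True
    have ib: "off i \<le> B" "nbr (off i) < n"
      using le nbr_E[OF s(2), of 0] True E_less by auto
    have "fits B enter s"
      using s le small[OF s(2)] small[OF ib(2)] by (simp add: enter_def scanned_def)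
    then obtain t1 where t1: "t1 \<le> time enter" "exec B enter s t1 (run enter s)"
      using exec_loopfree[of enter B s] by (auto simp: enter_def)
    define s1 where "s1 = run enter s"
    have s1: "mem s1 = mem s" "reg s1 ''i'' = i" "reg s1 ''n'' = n" "reg s1 ''y'' = i"
      "reg s1 ''x'' = nbr (off i)"
      using s by (simp_all add: s1_def enter_def scanned_def)
    have "leg i i (nbr (off i))" using leg_start[OF True] nbr_E[OF s(2), of 0] True by simp
    then obtain t2 s2 where t2: "exec B (While climb_test climb_step) s1 t2 s2"
      "mem s2 = mem s1" "reg s2 ''i'' = i" "reg s2 ''n'' = n" "reg s2 ''y'' = base i"
      "reg s2 ''x'' = apex i" "t2 \<le> 1 + bcost climb_test + climb_time * card (hand i)"
      using climb_exec[OF B, of s1] s1 s unfolding scanned_def climb_time_def by auto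
    have "scanned i s2" using s t2 s1 by (simp add: scanned_def)
    then obtain t3 s3 where t3: "exec B (Seq note_leg incr) s2 t3 s3" "scanned (Suc i) s3"
      "t3 \<le> time (Seq note_leg incr)"
      using note_leg_exec[of i s2] s(2) True t2 by blast
    \<comment> \<open>The invariant advances only with the increment, so \<open>note_leg\<close> and
      \<open>incr\<close> were run together; here they are separated to fit the bracketing of
      \<open>visit\<close>.\<close>
    then obtain t4 s4 t5 where t4: "exec B note_leg s2 t4 s4" "exec B incr s4 t5 s3" "t3 = t4 + t5"
      by (auto elim: exec_SeqE)
    have "exec B visit s (1 + bcost visit_test + (t1 + (t2 + t4))) s4"
      unfolding visit_def
      using fits bval True t1 t2 t4 by (intro exec.IfTrue exec.Seq) (auto simp: s1_def)
    then have "exec B (Seq visit incr) s (1 + bcost visit_test + (t1 + (t2 + t4)) + t5) s3"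
      using t4(2) by (rule exec.Seq)
    moreover have "1 + bcost visit_test + (t1 + (t2 + t4)) + t5 \<le>
        visit_time + climb_time * (if deg i = 1 then card (hand i) else 0)"
      using t1(1) t2(7) t3(3) t4(3) True by (simp add: visit_time_def)
    ultimately show ?thesis using t3(2) by blast
  qed
qed

lemma scan_exec:
  "\<exists>t s. exec B (While scan_test (Seq visit incr)) (input_state xs) t s \<and> scanned n s \<and>
    t \<le> (2 * (1 + bcost scan_test) + visit_time + 2 * climb_time) * n"
proof -
  define K where "K = 1 + bcost scan_test"
  \<comment> \<open>A single visit may be long; the last sum is the climbing left to the leaves not
    yet visited.\<close>
  define \<phi> where "\<phi> s = K + (K + visit_time) * (n - reg s ''i'') +
      climb_time * (\<Sum>l\<in>{l \<in> leaves. reg s ''i'' \<le> l}. card (hand l))" for s :: state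
  define I where "I s \<longleftrightarrow> scanned (reg s ''i'') s" for s
  let ?s = "input_state xs"
  have "\<exists>t s. exec B (While scan_test (Seq visit incr)) ?s t s \<and> I s \<and> \<not> bval s scan_test \<and> t \<le> \<phi> ?s"
  proof (rule exec_while)
    have "tally 0 = (\<lambda>_. 0)" by (simp add: tally_def fun_eq_iff)
    then show "I ?s"
      by (simp add: I_def scanned_def input_state_def shorts_def longs_def fun_eq_iff)
  next
    fix s assume s: "I s"
    define i where "i = reg s ''i''"
    have i: "scanned i s" "i \<le> n" using s by (simp_all add: I_def i_def scanned_def)
    show "bfits B s scan_test" using i B by (simp add: scan_test_def scanned_def)
    show "1 + bcost scan_test \<le> \<phi> s" by (simp add: \<phi>_def K_def)
    assume "bval s scan_test"
    then have "i < n" using i(1) by (simp add: scan_test_def scanned_def)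
    obtain t s' where t: "exec B (Seq visit incr) s t s'" "scanned (Suc i) s'"
      "t \<le> visit_time + climb_time * (if deg i = 1 then card (hand i) else 0)"
      using visit_exec[OF i(1) \<open>i < n\<close>] by blast
    have i': "reg s' ''i'' = Suc i" using t(2) by (simp add: scanned_def)
    have "{l \<in> leaves. i \<le> l} = {l \<in> leaves. Suc i \<le> l} \<union> (if deg i = 1 then {i} else {})"
      by (auto simp: le_less Suc_le_eq)
    then have "(\<Sum>l\<in>{l \<in> leaves. i \<le> l}. card (hand l)) =
        (\<Sum>l\<in>{l \<in> leaves. Suc i \<le> l}. card (hand l)) + (if deg i = 1 then card (hand i) else 0)"
      by (auto simp: sum.union_disjoint)
    moreover have "n - i = Suc (n - Suc i)" using \<open>i < n\<close> by simp
    ultimately have "1 + bcost scan_test + t + \<phi> s' \<le> \<phi> s"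
      using t(3) unfolding \<phi>_def i' i_def[symmetric] by (simp add: K_def algebra_simps)
    moreover have "I s'" using t(2) i' by (simp add: I_def)
    ultimately show "\<exists>t s'. exec B (Seq visit incr) s t s' \<and> I s' \<and>
        1 + bcost scan_test + t + \<phi> s' \<le> \<phi> s"
      using t(1) by blast
  qed
  then obtain t s where ts: "exec B (While scan_test (Seq visit incr)) ?s t s" "I s"
    "\<not> bval s scan_test" "t \<le> \<phi> ?s" by blast
  then have "scanned n s"
    by (auto simp: I_def scan_test_def scanned_def)
  have "\<phi> ?s = K + (K + visit_time) * n + climb_time * (\<Sum>l\<in>leaves. card (hand l))"
    by (simp add: \<phi>_def input_state_def)
  \<comment> \<open>The final failing test costs \<open>K\<close>, which is at most
    \<open>K * n\<close>.\<close>
  also have "\<dots> \<le> K * n + (K + visit_time) * n + climb_time * (2 * n)"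
    using card_hands nonempty by (intro add_mono mult_le_mono) (auto simp: V_eq Suc_le_eq)
  also have "\<dots> = (2 * K + visit_time + 2 * climb_time) * n" by (simp add: algebra_simps)
  finally show ?thesis using ts(1,4) \<open>scanned n s\<close> unfolding K_def by (meson order_trans)
qed

lemma mark_exec:
  assumes s: "marked i s" "i < n"
  shows "\<exists>t s'. exec B (Seq mark incr) s t s' \<and> marked (Suc i) s' \<and> t \<le> time (Seq mark incr)"
proof -
  have cnt: "tally n v \<le> B" for v using tally_le[of n v] B by linarith
  have small: "Suc 0 \<le> B" "i \<le> B" "Suc i \<le> B" using less_B[OF B s(2)] by linarith+
  have "fits B (Seq mark incr) s"
    using s cnt small by (simp add: mark_def incr_def marked_def)
  then obtain t where t: "t \<le> time (Seq mark incr)"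
    "exec B (Seq mark incr) s t (run (Seq mark incr) s)"
    using exec_loopfree[of "Seq mark incr" B s] by (auto simp: mark_def incr_def)
  have "marked (Suc i) (run (Seq mark incr) s)"
    using s unfolding marked_def mark_def incr_def
    by (auto simp: fun_eq_iff stems_iff[of i] less_Suc_eq)
  then show ?thesis using t by blast
qed

lemma mark_all_exec:
  assumes "marked 0 s"
  shows "\<exists>t s'. exec B (While scan_test (Seq mark incr)) s t s' \<and> marked n s' \<and>
    t \<le> (2 * (1 + bcost scan_test) + time (Seq mark incr)) * n"
proof -
  define K where "K = 1 + bcost scan_test"
  define \<phi> where "\<phi> s = K + (K + time (Seq mark incr)) * (n - reg s ''i'')" for s :: state
  define I where "I s \<longleftrightarrow> marked (reg s ''i'') s" for s
  have "\<exists>t s'. exec B (While scan_test (Seq mark incr)) s t s' \<and> I s' \<and>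
      \<not> bval s' scan_test \<and> t \<le> \<phi> s"
  proof (rule exec_while)
    show "I s" using assms by (simp add: I_def marked_def)
  next
    fix s assume s: "I s"
    define i where "i = reg s ''i''"
    have i: "marked i s" "i \<le> n" using s by (simp_all add: I_def i_def marked_def)
    show "bfits B s scan_test" using i B by (simp add: scan_test_def marked_def)
    show "1 + bcost scan_test \<le> \<phi> s" by (simp add: \<phi>_def K_def)
    assume "bval s scan_test"
    then have "i < n" using i(1) by (simp add: scan_test_def marked_def)
    obtain t s' where t: "exec B (Seq mark incr) s t s'" "marked (Suc i) s'"
      "t \<le> time (Seq mark incr)"
      using mark_exec[OF i(1) \<open>i < n\<close>] by blast
    have i': "reg s' ''i'' = Suc i" using t(2) by (simp add: marked_def)
    have "n - i = Suc (n - Suc i)" using \<open>i < n\<close> by simp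
    then have "1 + bcost scan_test + t + \<phi> s' \<le> \<phi> s"
      using t(3) unfolding \<phi>_def i' i_def[symmetric] by (simp add: K_def)
    moreover have "I s'" using t(2) i' by (simp add: I_def)
    ultimately show "\<exists>t s'. exec B (Seq mark incr) s t s' \<and> I s' \<and>
        1 + bcost scan_test + t + \<phi> s' \<le> \<phi> s"
      using t(1) by blast
  qed
  then obtain t s' where ts: "exec B (While scan_test (Seq mark incr)) s t s'" "I s'"
    "\<not> bval s' scan_test" "t \<le> \<phi> s" by blast
  then have "marked n s'"
    by (auto simp: I_def scan_test_def marked_def)
  have "\<phi> s = K + (K + time (Seq mark incr)) * n"
    using assms by (simp add: \<phi>_def marked_def)
  also have "\<dots> \<le> K * n + (K + time (Seq mark incr)) * n"
    using nonempty by (auto simp: Suc_le_eq)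
  also have "\<dots> = (2 * K + time (Seq mark incr)) * n" by (simp add: algebra_simps)
  finally show ?thesis using ts(1,4) \<open>marked n s'\<close> unfolding K_def by (meson order_trans)
qed

end

lemma detect_exec:
  "\<exists>t s. exec (detect_time * n) detect (input_state xs) t s \<and> t \<le> detect_time * n \<and>
    output_set s ''W'' n = stems \<and> output_set s ''L'' n = stems \<union> tips"
proof -
  \<comment> \<open>One number serves as word bound and as time bound.\<close>
  let ?B = "detect_time * n"
  have B: "10 * n \<le> ?B" by (rule mult_le_mono1) (simp add: detect_time_def)
  have n: "1 \<le> n" using nonempty by (simp add: Suc_le_eq)
  obtain t1 s1 where 1: "exec ?B (While scan_test (Seq visit incr)) (input_state xs) t1 s1"
    "scanned n s1" "t1 \<le> (2 * (1 + bcost scan_test) + visit_time + 2 * climb_time) * n"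
    using scan_exec[OF B] by blast
  define s2 where "s2 = s1\<lparr>reg := (reg s1)(''i'' := 0)\<rparr>"
  have 2: "exec ?B (Assign ''i'' (N 0)) s1 (time (Assign ''i'' (N 0))) s2"
    using exec.Assign[of ?B s1 "N 0" "''i''"] by (simp add: s2_def)
  have less: "x < n" if "x \<in> tips \<or> x \<in> stems" for x
    using that tips_V stems_V V_eq by blast
  have "marked 0 s2"
    using 1(2) less by (auto simp: s2_def marked_def scanned_def fun_eq_iff)
  then obtain t3 s3 where 3: "exec ?B (While scan_test (Seq mark incr)) s2 t3 s3"
    "marked n s3" "t3 \<le> (2 * (1 + bcost scan_test) + time (Seq mark incr)) * n"
    using mark_all_exec[OF B] by blast
  have "exec ?B detect (input_state xs) (t1 + (time (Assign ''i'' (N 0)) + t3)) s3"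
    unfolding detect_def using 1(1) 2 3(1) by (intro exec.Seq)
  moreover have "t1 + (time (Assign ''i'' (N 0)) + t3) \<le> ?B"
    using 1(3) 3(3) n unfolding detect_time_def by (simp add: algebra_simps)
  moreover have "output_set s3 ''W'' n = stems" "output_set s3 ''L'' n = stems \<union> tips"
    using 3(2) less by (auto simp: output_set_def marked_def)
  ultimately show ?thesis by blast
qed

end

theorem theorem8:
  shows "\<exists>(p :: com) (c :: nat). \<forall>(T :: nat pair_pre_digraph) (xs :: nat list list).
    undirected_tree T \<and> adjacency_lists T xs \<longrightarrow>
    (\<exists>t s W L.
       exec (c * card (pverts T)) p (input_state xs) t s \<and>
       t \<le> c * card (pverts T) \<and>
       W = output_set s ''W'' (card (pverts T)) \<and>
       L = output_set s ''L'' (card (pverts T)) \<and>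
       detection_pair T W L \<and>
       card W + card L \<le> 2 * DP T)"
proof (rule exI[of _ detect], rule exI[of _ detect_time], intro allI impI)
  fix T :: "nat pair_pre_digraph" and xs
  assume *: "undirected_tree T \<and> adjacency_lists T xs"
  then have tree: "undirected_tree T" and "adjacency_lists T xs" by blast+
  then have V: "pverts T = {..<length xs}"
    and adj: "\<And>v. v < length xs \<Longrightarrow> distinct (xs ! v) \<and> set (xs ! v) = {u. (v, u) \<in> parcs T}"
    by (simp_all add: adjacency_lists_def)
  interpret metric_tree "pverts T" "\<lambda>u v. (u, v) \<in> parcs T" "dist_nat T"
    by (rule undirected_tree_metric_tree[OF tree])
  \<comment> \<open>Connectedness includes having a vertex; this supplies
    \<open>nonempty\<close>.\<close>
  have "pverts T \<noteq> {}"
    using tree by (simp add: undirected_tree_def connected_conv)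
  then interpret adjacency_tree "pverts T" "\<lambda>u v. (u, v) \<in> parcs T" "dist_nat T" xs
    using V adj by unfold_locales auto
  obtain t s where ts: "exec (detect_time * length xs) detect (input_state xs) t s"
    "t \<le> detect_time * length xs" "output_set s ''W'' (length xs) = stems"
    "output_set s ''L'' (length xs) = stems \<union> tips"
    using detect_exec by blast
  have "detection_pair T stems (stems \<union> tips)"
    using stems_tips_resolving stems_V tips_V by (simp add: detection_pair_iff_resolving[OF tree])
  \<comment> \<open>The lower bound is applied to an optimal pair, which \<open>DP_attained\<close>
    supplies.\<close>
  moreover have "card stems + card (stems \<union> tips) \<le> 2 * DP T"
    using DP_attained[of T] stems_tips_cost
    by (metis detection_pair_iff_resolving[OF tree])
  ultimately show "\<exists>t s W L.
       exec (detect_time * card (pverts T)) detect (input_state xs) t s \<and>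
       t \<le> detect_time * card (pverts T) \<and>
       W = output_set s ''W'' (card (pverts T)) \<and>
       L = output_set s ''L'' (card (pverts T)) \<and>
       detection_pair T W L \<and>
       card W + card L \<le> 2 * DP T"
    using ts by (intro exI[of _ t] exI[of _ s]) (simp add: V)
qed

end
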